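(* For all positive integers $n$ and $k$, the subset $\pi_n^{\mathrm{alg}}(\mathbb{S}^k)$ of algebraic homotopy classes is a subgroup of the homotopy group $\pi_n(\mathbb{S}^k)$.
   Context: $\mathbb{S}^n\subset\mathbb{R}^{n+1}$ is the standard unit sphere with its usual real algebraic structure, with base point $e=(1,0,\dots,0)$. A map $f:X\to Y$ between real algebraic sets $X\subset\mathbb{R}^a$, $Y\subset\mathbb{R}^b$ is regular if each of its components can be written as $P/Q$ on $X$, with $P,Q$ real polynomials and $Q$ nowhere vanishing on $X$. $\pi_n(\mathbb{S}^k)=\pi_n(\mathbb{S}^k,e)$ is the group of homotopy classes of pointed continuous maps $(\mathbb{S}^n,e)\to(\mathbb{S}^k,e)$. The set $\pi_n^{\mathrm{alg}}(\mathbb{S}^k)\subset\pi_n(\mathbb{S}^k)$ consists of those classes that have a representative $(\mathbb{S}^n,e)\to(\mathbb{S}^k,e)$ which is a regular map. *)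

theory Defs
  imports "HOL-Analysis.Analysis" "HOL-Algebra.Group"
begin

text \<open>
  Points of \<open>\<real>\<^sup>m\<close> are functions \<^typ>\<open>nat \<Rightarrow> real\<close> vanishing at all indices \<open>\<ge> m\<close>, as in the library's
  \<^const>\<open>nsphere\<close>: \<open>nsphere n\<close> is the unit sphere in the \<open>n + 1\<close> coordinates \<open>0, \<dots>, n\<close>.
\<close>

inductive poly_fun :: "nat \<Rightarrow> ((nat \<Rightarrow> real) \<Rightarrow> real) \<Rightarrow> bool" for m :: nat
where
  coord: "i < m \<Longrightarrow> poly_fun m (\<lambda>x. x i)"
| const: "poly_fun m (\<lambda>x. c)"
| add: "poly_fun m P \<Longrightarrow> poly_fun m Q \<Longrightarrow> poly_fun m (\<lambda>x. P x + Q x)"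
| mult: "poly_fun m P \<Longrightarrow> poly_fun m Q \<Longrightarrow> poly_fun m (\<lambda>x. P x * Q x)"

text \<open>Regular maps between \<open>X \<subseteq> \<real>\<^sup>a\<close> and \<open>Y \<subseteq> \<real>\<^sup>b\<close>; values of \<open>f\<close> outside \<open>X\<close> are irrelevant.\<close>

definition regular_map ::
  "nat \<Rightarrow> (nat \<Rightarrow> real) set \<Rightarrow> nat \<Rightarrow> (nat \<Rightarrow> real) set \<Rightarrow> ((nat \<Rightarrow> real) \<Rightarrow> (nat \<Rightarrow> real)) \<Rightarrow> bool"
where
  "regular_map a X b Y f \<longleftrightarrow>
     f ` X \<subseteq> Y \<and>
     (\<forall>i<b. \<exists>P Q. poly_fun a P \<and> poly_fun a Q \<and>
        (\<forall>x\<in>X. Q x \<noteq> 0) \<and> (\<forall>x\<in>X. f x i = P x / Q x))"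

definition base_pt :: "nat \<Rightarrow> real"
  where "base_pt = (\<lambda>i. if i = 0 then 1 else 0)"

definition pointed_maps :: "nat \<Rightarrow> nat \<Rightarrow> ((nat \<Rightarrow> real) \<Rightarrow> (nat \<Rightarrow> real)) set"
  where "pointed_maps n k = {f. continuous_map (nsphere n) (nsphere k) f \<and> f base_pt = base_pt}"

text \<open>
  Maps that agree on the sphere are identified by this relation, so the junk values outside the
  sphere do not affect its classes.
\<close>

definition pointed_homotopy ::
  "nat \<Rightarrow> nat \<Rightarrow> (((nat \<Rightarrow> real) \<Rightarrow> (nat \<Rightarrow> real)) \<times> ((nat \<Rightarrow> real) \<Rightarrow> (nat \<Rightarrow> real))) set"
where
  "pointed_homotopy n k =
     {(f, g). homotopic_with (\<lambda>h. h base_pt = base_pt) (nsphere n) (nsphere k) f g}"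

text \<open>
  The usual sum of pointed maps out of a sphere of dimension \<open>n \<ge> 1\<close>, i.e. the composite of the pinch
  \<open>S\<^sup>n \<rightarrow> S\<^sup>n \<or> S\<^sup>n\<close> with \<open>f \<or> g\<close>. The equator \<open>x 1 = 0\<close>, which contains the base point, is collapsed
  to the base point; \<open>pinch\<close> maps each of the open hemispheres \<open>x 1 > 0\<close> and \<open>x 1 < 0\<close>
  homeomorphically onto the complement of the base point. On a closed hemisphere it is
  \<open>x \<mapsto> 2 \<langle>x, p\<rangle> x - p\<close>, where \<open>p\<close> is the pole (this doubles the distance from \<open>p\<close> and sends the
  equator to \<open>- p\<close>), followed by the quarter turn in the coordinates \<open>0, 1\<close> that takes \<open>- p\<close> to the
  base point. Both hemispheres are mapped with degree \<open>1\<close>; without the absolute value the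
  degree on \<open>x 1 < 0\<close> would be \<open>(-1)^(n - 1)\<close>. For \<open>n = 1\<close> and \<open>x = (cos t, sin t)\<close> one gets \<open>pinch x = (cos (2t), sin (2t))\<close>, so
  that \<open>sphere_mult f g\<close> is the loop \<open>f\<close> followed by the loop \<open>g\<close>.
\<close>

definition pinch :: "(nat \<Rightarrow> real) \<Rightarrow> (nat \<Rightarrow> real)"
where
  "pinch x = (\<lambda>i. if i = 0 then 1 - 2 * (x 1)\<^sup>2
                  else if i = 1 then 2 * x 1 * x 0
                  else 2 * \<bar>x 1\<bar> * x i)"

definition sphere_mult ::
  "((nat \<Rightarrow> real) \<Rightarrow> (nat \<Rightarrow> real)) \<Rightarrow> ((nat \<Rightarrow> real) \<Rightarrow> (nat \<Rightarrow> real)) \<Rightarrow> (nat \<Rightarrow> real) \<Rightarrow> (nat \<Rightarrow> real)"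
where
  "sphere_mult f g x = (if x 1 \<ge> 0 then f (pinch x) else g (pinch x))"

definition homotopy_group :: "nat \<Rightarrow> nat \<Rightarrow> ((nat \<Rightarrow> real) \<Rightarrow> (nat \<Rightarrow> real)) set monoid"
where
  "homotopy_group n k =
     \<lparr>carrier = pointed_maps n k // pointed_homotopy n k,
      mult = (\<lambda>A B. \<Union>f\<in>A. \<Union>g\<in>B. pointed_homotopy n k `` {sphere_mult f g}),
      one = pointed_homotopy n k `` {\<lambda>x. base_pt}\<rparr>"

definition alg_homotopy_classes :: "nat \<Rightarrow> nat \<Rightarrow> ((nat \<Rightarrow> real) \<Rightarrow> (nat \<Rightarrow> real)) set set"
where
  "alg_homotopy_classes n k =
     {A \<in> carrier (homotopy_group n k).
        \<exists>f\<in>A. regular_map (Suc n) (topspace (nsphere n)) (Suc k) (topspace (nsphere k)) f}"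

lemma equiv_pointed_homotopy: "equiv (pointed_maps n k) (pointed_homotopy n k)"
proof (rule equivI)
  show "pointed_homotopy n k \<subseteq> pointed_maps n k \<times> pointed_maps n k"
  proof clarify
    fix f g assume "(f, g) \<in> pointed_homotopy n k"
    then have h: "homotopic_with (\<lambda>h. h base_pt = base_pt) (nsphere n) (nsphere k) f g"
      by (simp add: pointed_homotopy_def)
    show "f \<in> pointed_maps n k \<and> g \<in> pointed_maps n k"
      using homotopic_with_imp_continuous_maps[OF h] homotopic_with_imp_property[OF h]
      by (simp add: pointed_maps_def)
  qed
  show "refl_on (pointed_maps n k) (pointed_homotopy n k)"
    by (auto simp: refl_on_def pointed_homotopy_def pointed_maps_def)
  show "sym (pointed_homotopy n k)"
  proof (rule symI)
    fix f g assume "(f, g) \<in> pointed_homotopy n k"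
    then show "(g, f) \<in> pointed_homotopy n k"
      unfolding pointed_homotopy_def mem_Collect_eq case_prod_conv by (rule homotopic_with_symD)
  qed
  show "trans (pointed_homotopy n k)"
  proof (rule transI)
    fix f g h assume "(f, g) \<in> pointed_homotopy n k" "(g, h) \<in> pointed_homotopy n k"
    then show "(f, h) \<in> pointed_homotopy n k"
      unfolding pointed_homotopy_def mem_Collect_eq case_prod_conv by (rule homotopic_with_trans)
  qed
qed

lemma base_pt_in_nsphere: "base_pt \<in> topspace (nsphere n)"
proof -
  have "(\<Sum>i\<le>n. (base_pt i)\<^sup>2) = (\<Sum>i\<le>n. if i = 0 then 1 else 0)"
    by (intro sum.cong) (auto simp: base_pt_def)
  then show ?thesis
    by (simp add: nsphere base_pt_def)
qed

lemma continuous_map_pinch: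
  assumes n: "n \<ge> 1"
  shows "continuous_map (nsphere n) (nsphere n) pinch"
proof -
  have co: "continuous_map (nsphere n) euclideanreal (\<lambda>x. x i)" for i
    unfolding nsphere by (intro continuous_map_from_subtopology continuous_map_product_projection) auto
  have "continuous_map (nsphere n) euclideanreal (\<lambda>x. pinch x i)" for i
    unfolding pinch_def using co
    by (cases "i = 0"; cases "i = 1") (auto intro!: continuous_intros)
  then have 1: "continuous_map (nsphere n) (powertop_real UNIV) pinch"
    by (simp add: continuous_map_componentwise_UNIV)
  have 2: "(\<Sum>i\<le>n. (pinch x i)\<^sup>2) = 1 \<and> (\<forall>i>n. pinch x i = 0)" if "x \<in> topspace (nsphere n)" for x
  proof
    have x: "(\<Sum>i\<le>n. (x i)\<^sup>2) = 1" "\<forall>i>n. x i = 0"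
      using that by (auto simp: nsphere)
    then show "\<forall>i>n. pinch x i = 0"
      using n by (auto simp: pinch_def)
    have split: "{..n} = insert 0 (insert 1 {2..n})"
      using n by auto
    have "(\<Sum>i=2..n. (pinch x i)\<^sup>2) = (\<Sum>i=2..n. 4 * (x 1)\<^sup>2 * (x i)\<^sup>2)"
      by (intro sum.cong) (auto simp: pinch_def power_mult_distrib)
    also have "\<dots> = 4 * (x 1)\<^sup>2 * (1 - (x 0)\<^sup>2 - (x 1)\<^sup>2)"
      using x(1) by (simp add: split sum_distrib_left[symmetric])
    finally show "(\<Sum>i\<le>n. (pinch x i)\<^sup>2) = 1"
      by (simp add: split) (simp add: pinch_def power2_eq_square algebra_simps)
  qed
  show ?thesis
    using 1 2 unfolding nsphere[of n] continuous_map_in_subtopology by (auto simp: nsphere)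
qed

lemma pinch_equator: "x 1 = 0 \<Longrightarrow> pinch x = base_pt"
  by (auto simp: pinch_def base_pt_def)

lemma homotopic_sphere_mult:
  assumes n: "n \<ge> 1"
    and ff': "(f, f') \<in> pointed_homotopy n k" and gg': "(g, g') \<in> pointed_homotopy n k"
  shows "(sphere_mult f g, sphere_mult f' g') \<in> pointed_homotopy n k"
proof -
  let ?T = "prod_topology (top_of_set {0..1::real}) (nsphere n)"
  obtain H where H: "continuous_map ?T (nsphere k) H"
      "\<And>x. H (0, x) = f x" "\<And>x. H (1, x) = f' x" "\<And>t. t \<in> {0..1} \<Longrightarrow> H (t, base_pt) = base_pt"
    using ff' unfolding pointed_homotopy_def homotopic_with_def by auto
  obtain K where K: "continuous_map ?T (nsphere k) K"
      "\<And>x. K (0, x) = g x" "\<And>x. K (1, x) = g' x" "\<And>t. t \<in> {0..1} \<Longrightarrow> K (t, base_pt) = base_pt"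
    using gg' unfolding pointed_homotopy_def homotopic_with_def by auto
  let ?L = "\<lambda>(t, x). if 0 \<le> x 1 then H (t, pinch x) else K (t, pinch x)"
  have p: "continuous_map ?T ?T (\<lambda>(t, x). (t, pinch x))"
    using continuous_map_pinch[OF n]
    by (simp add: case_prod_unfold continuous_map_pairwise o_def continuous_map_fst
        continuous_map_compose[OF continuous_map_snd, unfolded o_def])
  have co: "continuous_map ?T euclideanreal (\<lambda>z. snd z 1)"
  proof -
    have "continuous_map (nsphere n) euclideanreal (\<lambda>x. x 1)"
      unfolding nsphere by (intro continuous_map_from_subtopology continuous_map_product_projection) auto
    from continuous_map_compose[OF continuous_map_snd this] show ?thesis by (simp add: o_def)
  qed
  have "continuous_map ?T (nsphere k)
     (\<lambda>z. if (0::real) \<le> snd z 1 then (H \<circ> (\<lambda>(t, x). (t, pinch x))) z else (K \<circ> (\<lambda>(t, x). (t, pinch x))) z)"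
  proof (rule continuous_map_cases_le)
    show "continuous_map (subtopology ?T {z \<in> topspace ?T. 0 \<le> snd z 1}) (nsphere k)
           (H \<circ> (\<lambda>(t, x). (t, pinch x)))"
      by (intro continuous_map_from_subtopology continuous_map_compose[OF p H(1)])
    show "continuous_map (subtopology ?T {z \<in> topspace ?T. snd z 1 \<le> 0}) (nsphere k)
           (K \<circ> (\<lambda>(t, x). (t, pinch x)))"
      by (intro continuous_map_from_subtopology continuous_map_compose[OF p K(1)])
    show "(H \<circ> (\<lambda>(t, x). (t, pinch x))) z = (K \<circ> (\<lambda>(t, x). (t, pinch x))) z"
      if "z \<in> topspace ?T" "0 = snd z 1" for z
      using that H(4) K(4) pinch_equator[of "snd z"] by (cases z) auto
  qed (use co in auto)
  then have "continuous_map ?T (nsphere k) ?L"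
    unfolding case_prod_unfold o_def .
  moreover have "pinch base_pt = base_pt"
    by (rule pinch_equator) (simp add: base_pt_def)
  ultimately have "homotopic_with (\<lambda>h. h base_pt = base_pt) (nsphere n) (nsphere k)
                     (sphere_mult f g) (sphere_mult f' g')"
    unfolding homotopic_with_def
    by (intro exI[of _ ?L] conjI allI ballI) (simp_all add: sphere_mult_def H(2-4) K(2-4))
  then show ?thesis
    by (simp add: pointed_homotopy_def)
qed

lemma homotopy_group_mult:
  assumes n: "n \<ge> 1" and f: "f \<in> pointed_maps n k" and g: "g \<in> pointed_maps n k"
  shows "(pointed_homotopy n k `` {f}) \<otimes>\<^bsub>homotopy_group n k\<^esub> (pointed_homotopy n k `` {g})
       = pointed_homotopy n k `` {sphere_mult f g}"
proof -
  have "congruent2 (pointed_homotopy n k) (pointed_homotopy n k)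
          (\<lambda>f g. pointed_homotopy n k `` {sphere_mult f g})"
    unfolding congruent2_def
    by (auto intro!: equiv_class_eq[OF equiv_pointed_homotopy] homotopic_sphere_mult[OF n]
        simp del: Image_singleton_iff)
  from UN_equiv_class2[OF equiv_pointed_homotopy equiv_pointed_homotopy this f g]
  show ?thesis by (simp add: homotopy_group_def)
qed

end

theory Submission
  imports Defs
begin

text \<open>
  View the target sphere as \<open>\<real>\<^sup>k \<union> {\<infinity>}\<close> with base point \<open>0\<close>, and the source sphere as
  \<open>\<real>\<^sup>n \<union> {\<infinity>}\<close> with base point \<open>\<infinity>\<close>. Translations extend to regular maps, and addition extends to
  a regular map on all pairs of points of the target except \<open>(\<infinity>, \<infinity>)\<close>. Let \<open>f\<close>, \<open>g\<close> be regular and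
  pointed. After a dilation of the source their poles lie in the open unit ball, so for a unit vector
  \<open>p\<close> the maps \<open>f (a - p)\<close> and \<open>g (a + p)\<close> have no common pole and their sum
  \<open>f (a - p) + g (a + p)\<close> is regular. It represents the sum of the homotopy classes: the translation
  by \<open>- p\<close> is nowhere antipodal to the map that pinches one hemisphere, and the great circle homotopy
  between the two keeps the poles of the two summands in different hemispheres. Inverses are obtained
  by composition with a reflection.
\<close>

section \<open>The sphere as a compact set of real sequences\<close>

definition usphere :: "nat \<Rightarrow> (nat \<Rightarrow> real) set"
  where "usphere n = {x. (\<Sum>i\<le>n. (x i)\<^sup>2) = 1 \<and> (\<forall>i>n. x i = 0)}"

text \<open>Replaces abstract topologies by a subspace of the function space, so that
  \<open>continuous_on\<close> and its rules become available.\<close>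

lemma nsphere_eq_top_of_set: "nsphere n = top_of_set (usphere n)"
  by (simp add: nsphere usphere_def euclidean_product_topology)

lemma topspace_nsphere: "topspace (nsphere n) = usphere n"
  by (simp add: nsphere_eq_top_of_set)

lemma prod_topology_nsphere:
  "prod_topology (top_of_set T) (nsphere n) = top_of_set (T \<times> usphere n)"
  by (simp add: nsphere_eq_top_of_set prod_topology_subtopology_eu)

lemma base_pt_in_usphere [simp]: "base_pt \<in> usphere n"
  using base_pt_in_nsphere by (simp add: topspace_nsphere)

lemma base_pt_simps [simp]: "base_pt 0 = 1" "i \<noteq> 0 \<Longrightarrow> base_pt i = 0"
  by (auto simp: base_pt_def)

lemma sum_atMost_split1:
  fixes g :: "nat \<Rightarrow> real"
  shows "(\<Sum>i\<le>k. g i) = g 0 + (\<Sum>i=1..k. g i)"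
proof -
  have "{..k} = insert 0 {1..k}" by auto
  then show ?thesis by simp
qed

lemma sum_atMost_split2:
  fixes g :: "nat \<Rightarrow> real"
  assumes "n \<ge> 1"
  shows "(\<Sum>i\<le>n. g i) = g 0 + g 1 + (\<Sum>i=2..n. g i)"
proof -
  have "{..n} = insert 0 (insert 1 {2..n})" using assms by auto
  then show ?thesis by simp
qed

lemma usphere_sum2:
  assumes "x \<in> usphere n" "n \<ge> 1"
  shows "(\<Sum>i=2..n. (x i)\<^sup>2) = 1 - (x 0)\<^sup>2 - (x 1)\<^sup>2"
  using assms sum_atMost_split2[of n "\<lambda>i. (x i)\<^sup>2"] by (simp add: usphere_def)

lemma usphere_sum1:
  assumes "x \<in> usphere n"
  shows "(\<Sum>i=1..n. (x i)\<^sup>2) = 1 - (x 0)\<^sup>2"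
  using assms sum_atMost_split1[of "\<lambda>i. (x i)\<^sup>2" n] by (simp add: usphere_def)

lemma usphere_zero: "x \<in> usphere n \<Longrightarrow> i > n \<Longrightarrow> x i = 0"
  by (simp add: usphere_def)

lemma usphereI2:
  assumes "n \<ge> 1" "(x 0)\<^sup>2 + (x 1)\<^sup>2 + (\<Sum>i=2..n. (x i)\<^sup>2) = 1" "\<And>i. i > n \<Longrightarrow> x i = 0"
  shows "x \<in> usphere n"
  using assms sum_atMost_split2[of n "\<lambda>i. (x i)\<^sup>2"] by (simp add: usphere_def)

lemma usphere_coord_le: 
  assumes "x \<in> usphere n" shows "\<bar>x i\<bar> \<le> 1"
proof (cases "i \<le> n")
  case True
  then have "(x i)\<^sup>2 \<le> (\<Sum>i\<le>n. (x i)\<^sup>2)"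
    by (intro member_le_sum) auto
  then show ?thesis
    using assms by (simp add: usphere_def abs_square_le_1)
next
  case False
  then show ?thesis using assms by (simp add: usphere_def)
qed

lemma usphere_coord0_eq_1:
  assumes "x \<in> usphere n" "x 0 = 1" shows "x = base_pt"
proof -
  have "(\<Sum>i=1..n. (x i)\<^sup>2) = 0"
    using usphere_sum1[OF assms(1)] assms(2) by simp
  then have "\<forall>i\<in>{1..n}. (x i)\<^sup>2 = 0"
    by (subst (asm) sum_nonneg_eq_0_iff) auto
  then have "x i = base_pt i" for i
    using assms usphere_zero[OF assms(1), of i] by (cases "i = 0"; cases "i \<le> n") auto
  then show ?thesis by auto
qed

text \<open>A closed subset of a product of intervals, compact by Tychonoff. Compactness later
  bounds the poles of a map.\<close>

lemma compact_usphere: "compact (usphere n)"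
proof -
  have "compact (PiE UNIV (\<lambda>i::nat. {-1..1::real}))"
    using compactin_PiE[of "\<lambda>i::nat. euclideanreal" UNIV "\<lambda>i. {-1..1}"]
    by (simp add: euclidean_product_topology)
  moreover have "closed (usphere n)"
  proof -
    have "usphere n = {x. (\<Sum>i\<le>n. (x i)\<^sup>2) = 1} \<inter> (\<Inter>i\<in>{n<..}. {x. x i = 0})"
      by (auto simp: usphere_def)
    moreover have "closed {x::nat\<Rightarrow>real. (\<Sum>i\<le>n. (x i)\<^sup>2) = 1}"
      by (intro closed_Collect_eq continuous_intros continuous_on_product_coordinates)
    moreover have "closed {x::nat\<Rightarrow>real. x i = 0}" for i
      by (intro closed_Collect_eq continuous_intros continuous_on_product_coordinates)
    ultimately show ?thesis by (simp add: closed_Int closed_INT)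
  qed
  ultimately have "compact (PiE UNIV (\<lambda>i::nat. {-1..1::real}) \<inter> usphere n)"
    by (rule compact_Int_closed)
  moreover have "PiE UNIV (\<lambda>i::nat. {-1..1::real}) \<inter> usphere n = usphere n"
    using usphere_coord_le by (auto simp: abs_le_iff PiE_UNIV_domain minus_le_iff)
  ultimately show ?thesis by simp
qed

section \<open>Pointed maps and pointed homotopy\<close>

lemma pointed_maps_iff:
  "f \<in> pointed_maps n k \<longleftrightarrow>
     continuous_on (usphere n) f \<and> f ` usphere n \<subseteq> usphere k \<and> f base_pt = base_pt"
  by (auto simp: pointed_maps_def nsphere_eq_top_of_set image_subset_iff_funcset)

lemma pointed_maps_in: "f \<in> pointed_maps n k \<Longrightarrow> x \<in> usphere n \<Longrightarrow> f x \<in> usphere k"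
  by (auto simp: pointed_maps_iff)

lemma pointed_maps_base: "f \<in> pointed_maps n k \<Longrightarrow> f base_pt = base_pt"
  by (simp add: pointed_maps_def)

text \<open>By definition, \<open>homotopic_with\<close> asks for the endpoint equations off the
  sphere too. Since \<open>base_pt\<close> lies on the sphere, pointedness depends on the values
  there alone, and agreement on the sphere suffices.\<close>

lemma pointed_homotopyI:
  assumes "continuous_on ({0..1::real} \<times> usphere n) H"
    and "\<And>t x. t \<in> {0..1} \<Longrightarrow> x \<in> usphere n \<Longrightarrow> H (t, x) \<in> usphere k"
    and "\<And>t. t \<in> {0..1} \<Longrightarrow> H (t, base_pt) = base_pt"
    and "\<And>x. x \<in> usphere n \<Longrightarrow> H (0, x) = f x"
    and "\<And>x. x \<in> usphere n \<Longrightarrow> H (1, x) = g x"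
  shows "(f, g) \<in> pointed_homotopy n k"
proof -
  have "homotopic_with (\<lambda>h. h base_pt = base_pt) (nsphere n) (nsphere k) f g"
  proof (subst homotopic_with)
    show "h base_pt = base_pt \<longleftrightarrow> h' base_pt = base_pt"
      if "\<And>x. x \<in> topspace (nsphere n) \<Longrightarrow> h x = h' x" for h h' :: "(nat \<Rightarrow> real) \<Rightarrow> nat \<Rightarrow> real"
      using that[of base_pt] by (simp add: topspace_nsphere)
    show "\<exists>h. continuous_map (prod_topology (top_of_set {0..1::real}) (nsphere n)) (nsphere k) h \<and>
        (\<forall>x\<in>topspace (nsphere n). h (0, x) = f x) \<and>
        (\<forall>x\<in>topspace (nsphere n). h (1, x) = g x) \<and>
        (\<forall>t\<in>{0..1}. h (t, base_pt) = base_pt)"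
      using assms
      by (intro exI[of _ H]) (auto simp: prod_topology_nsphere topspace_nsphere nsphere_eq_top_of_set)
  qed
  then show ?thesis by (simp add: pointed_homotopy_def)
qed

lemma pointed_homotopy_maps:
  assumes "(f, g) \<in> pointed_homotopy n k"
  shows "f \<in> pointed_maps n k" "g \<in> pointed_maps n k"
  using equivE[OF equiv_pointed_homotopy[of n k]] assms by blast+

lemma pointed_homotopy_refl: "f \<in> pointed_maps n k \<Longrightarrow> (f, f) \<in> pointed_homotopy n k"
  using equivE[OF equiv_pointed_homotopy[of n k]] by (blast dest: refl_onD)

lemma pointed_homotopy_sym: "(f, g) \<in> pointed_homotopy n k \<Longrightarrow> (g, f) \<in> pointed_homotopy n k"
  using equivE[OF equiv_pointed_homotopy[of n k]] by (blast dest: symD)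

lemma pointed_homotopy_trans [trans]:
  "(f, g) \<in> pointed_homotopy n k \<Longrightarrow> (g, h) \<in> pointed_homotopy n k \<Longrightarrow> (f, h) \<in> pointed_homotopy n k"
  using equivE[OF equiv_pointed_homotopy[of n k]] by (blast dest: transD)

lemma pointed_homotopy_eq:
  assumes "f \<in> pointed_maps n k" "\<And>x. x \<in> usphere n \<Longrightarrow> f x = g x"
  shows "(f, g) \<in> pointed_homotopy n k"
  unfolding pointed_homotopy_def using assms
  using assms(2)[of base_pt]
  by (auto simp: pointed_maps_def topspace_nsphere intro!: homotopic_with_equal)

lemma pointed_maps_comp:
  "f \<in> pointed_maps m k \<Longrightarrow> q \<in> pointed_maps n m \<Longrightarrow> f \<circ> q \<in> pointed_maps n k"
  by (auto simp: pointed_maps_def intro: continuous_map_compose)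

lemma pointed_homotopy_comp_left:
  assumes "(p, q) \<in> pointed_homotopy n m" "f \<in> pointed_maps m k"
  shows "(f \<circ> p, f \<circ> q) \<in> pointed_homotopy n k"
  using assms unfolding pointed_homotopy_def pointed_maps_def
  by (auto elim!: homotopic_with_compose_continuous_map_left)

lemma pointed_homotopy_comp_right:
  assumes "(f, g) \<in> pointed_homotopy m k" "q \<in> pointed_maps n m"
  shows "(f \<circ> q, g \<circ> q) \<in> pointed_homotopy n k"
  using assms unfolding pointed_homotopy_def pointed_maps_def
  by (auto elim!: homotopic_with_compose_continuous_map_right)

lemma const_pointed [simp]: "(\<lambda>x. base_pt) \<in> pointed_maps n k"
  by (auto simp: pointed_maps_iff)

lemma id_pointed [simp]: "id \<in> pointed_maps n n"
  by (auto simp: pointed_maps_iff)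

lemma pinch_pointed: "n \<ge> 1 \<Longrightarrow> pinch \<in> pointed_maps n n"
  by (simp add: pointed_maps_def continuous_map_pinch pinch_equator)

lemma sphere_mult_pointed:
  assumes "n \<ge> 1" "f \<in> pointed_maps n k" "g \<in> pointed_maps n k"
  shows "sphere_mult f g \<in> pointed_maps n k"
  using homotopic_sphere_mult[OF assms(1)] assms(2,3) pointed_homotopy_refl pointed_homotopy_maps(1)
  by blast

lemmas continuous_on_coord = continuous_on_product_then_coordinatewise

lemma continuous_on_coord_id: "continuous_on S (\<lambda>x::nat \<Rightarrow> real. x i)"
  using continuous_on_coord[OF continuous_on_id] .

lemma continuous_on_coord_snd: "continuous_on T (\<lambda>z::real \<times> (nat \<Rightarrow> real). snd z i)"
  using continuous_on_coord[OF continuous_on_snd[OF continuous_on_id]] .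

section \<open>Great circle homotopies\<close>

text \<open>The segment from \<open>u\<close> to \<open>v\<close>, projected radially to the
  sphere.\<close>

definition great_arc :: "nat \<Rightarrow> real \<Rightarrow> (nat \<Rightarrow> real) \<Rightarrow> (nat \<Rightarrow> real) \<Rightarrow> nat \<Rightarrow> real"
  where "great_arc n t u v =
    (\<lambda>i. ((1 - t) * u i + t * v i) / sqrt (\<Sum>j\<le>n. ((1 - t) * u j + t * v j)\<^sup>2))"

lemma sum_segment_squares:
  assumes "u \<in> usphere n" "v \<in> usphere n"
  shows "(\<Sum>j\<le>n. ((1 - t) * u j + t * v j)\<^sup>2)
    = (1 - t)\<^sup>2 + t\<^sup>2 + 2 * t * (1 - t) * (\<Sum>j\<le>n. u j * v j)"
proof -
  have "(\<Sum>j\<le>n. ((1 - t) * u j + t * v j)\<^sup>2)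
    = (\<Sum>j\<le>n. (1 - t)\<^sup>2 * (u j)\<^sup>2 + t\<^sup>2 * (v j)\<^sup>2 + 2 * t * (1 - t) * (u j * v j))"
    by (intro sum.cong) (auto simp: power2_eq_square algebra_simps)
  also have "\<dots> = (1 - t)\<^sup>2 * (\<Sum>j\<le>n. (u j)\<^sup>2) + t\<^sup>2 * (\<Sum>j\<le>n. (v j)\<^sup>2)
      + 2 * t * (1 - t) * (\<Sum>j\<le>n. u j * v j)"
    by (simp only: sum.distrib sum_distrib_left)
  finally show ?thesis using assms by (simp add: usphere_def)
qed

text \<open>With \<open>c\<close> the inner product, the squared length is
  \<open>(1 - 2 * t)\<^sup>2 + 2 * (t * (1 - t)) * (1 + c)\<close>, which vanishes only at the
  midpoint between antipodes.\<close>

lemma sum_segment_squares_pos: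
  assumes "u \<in> usphere n" "v \<in> usphere n" "- 1 < (\<Sum>j\<le>n. u j * v j)" "t \<in> {0..1}"
  shows "0 < (\<Sum>j\<le>n. ((1 - t) * u j + t * v j)\<^sup>2)"
proof -
  define c where "c = (\<Sum>j\<le>n. u j * v j)"
  have "(1 - t)\<^sup>2 + t\<^sup>2 + 2 * t * (1 - t) * c = (1 - 2 * t)\<^sup>2 + 2 * (t * (1 - t)) * (1 + c)"
    by (simp add: power2_eq_square algebra_simps)
  moreover have "0 < (1 - 2 * t)\<^sup>2 + 2 * (t * (1 - t)) * (1 + c)"
  proof (cases "t = 0 \<or> t = 1")
    case False
    then have "0 < t * (1 - t) * (1 + c)" using assms by (auto simp: c_def)
    then show ?thesis by (simp add: add_nonneg_pos)
  qed auto
  ultimately show ?thesis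
    unfolding sum_segment_squares[OF assms(1,2)] c_def by simp
qed

lemma great_arc_in_usphere:
  assumes "u \<in> usphere n" "v \<in> usphere n" "- 1 < (\<Sum>j\<le>n. u j * v j)" "t \<in> {0..1}"
  shows "great_arc n t u v \<in> usphere n"
proof -
  define s where "s = (\<Sum>j\<le>n. ((1 - t) * u j + t * v j)\<^sup>2)"
  have "s > 0" unfolding s_def by (rule sum_segment_squares_pos[OF assms])
  then have "(\<Sum>j\<le>n. (great_arc n t u v j)\<^sup>2) = 1"
    unfolding great_arc_def s_def[symmetric]
    by (simp add: power_divide sum_divide_distrib[symmetric]) (simp add: s_def)
  then show ?thesis
    using assms(1,2) by (auto simp: usphere_def great_arc_def)
qed

lemma great_arc_0: "u \<in> usphere n \<Longrightarrow> great_arc n 0 u v = u"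
  and great_arc_1: "v \<in> usphere n \<Longrightarrow> great_arc n 1 u v = v"
  and great_arc_same: "u \<in> usphere n \<Longrightarrow> great_arc n t u u = u"
  by (auto simp: great_arc_def usphere_def algebra_simps)

text \<open>This convexity of the half \<open>x 0 \<ge> 0\<close> later keeps moving points away
  from the poles of the maps to be added.\<close>

lemma great_arc_coord0_nonneg:
  assumes "0 \<le> u 0" "0 \<le> v 0" "t \<in> {0..1}"
  shows "0 \<le> great_arc n t u v 0"
  using assms by (auto simp: great_arc_def intro!: divide_nonneg_nonneg sum_nonneg)

lemma continuous_on_pointed_snd:
  assumes "p \<in> pointed_maps m n"
  shows "continuous_on (T \<times> usphere m) (\<lambda>z. p (snd z))"
  by (rule continuous_on_compose2[of "usphere m" p _ snd])
    (use assms in \<open>auto simp: pointed_maps_iff intro: continuous_on_snd continuous_on_id\<close>)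

lemma continuous_on_great_arc:
  assumes p: "p \<in> pointed_maps m n" and q: "q \<in> pointed_maps m n"
    and pq: "\<And>x. x \<in> usphere m \<Longrightarrow> - 1 < (\<Sum>j\<le>n. p x j * q x j)"
  shows "continuous_on ({0..1} \<times> usphere m) (\<lambda>(t, x). great_arc n t (p x) (q x))"
proof -
  have nz: "\<forall>z\<in>{0..1} \<times> usphere m. sqrt (\<Sum>j\<le>n. ((1 - fst z) * p (snd z) j + fst z * q (snd z) j)\<^sup>2) \<noteq> 0"
  proof
    fix z assume z: "z \<in> {0..1::real} \<times> usphere m"
    then have "0 < (\<Sum>j\<le>n. ((1 - fst z) * p (snd z) j + fst z * q (snd z) j)\<^sup>2)"
      by (intro sum_segment_squares_pos pointed_maps_in[OF p] pointed_maps_in[OF q] pq) auto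
    then show "sqrt (\<Sum>j\<le>n. ((1 - fst z) * p (snd z) j + fst z * q (snd z) j)\<^sup>2) \<noteq> 0"
      by simp
  qed
  show ?thesis
    unfolding case_prod_unfold great_arc_def
    by (intro continuous_on_coordinatewise_then_product continuous_intros
      continuous_on_coord[OF continuous_on_pointed_snd[OF p]]
      continuous_on_coord[OF continuous_on_pointed_snd[OF q]] nz)
qed

text \<open>Radial projection of the straight-line homotopy. The base point stays fixed since an arc
  from a point to itself is constant.\<close>

lemma pointed_homotopy_great_arc:
  assumes p: "p \<in> pointed_maps m n" and q: "q \<in> pointed_maps m n"
    and pq: "\<And>x. x \<in> usphere m \<Longrightarrow> - 1 < (\<Sum>j\<le>n. p x j * q x j)"
  shows "(p, q) \<in> pointed_homotopy m n"
  by (rule pointed_homotopyI[OF continuous_on_great_arc[OF p q pq]])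
    (use p q pq in \<open>auto simp: great_arc_0 great_arc_1 great_arc_same pointed_maps_in pointed_maps_base
        intro!: great_arc_in_usphere\<close>)

section \<open>Translation and pinching\<close>

text \<open>
  Stereographic projection \<open>x \<mapsto> (x i / (1 - x 0))\<close> for \<open>i \<ge> 1\<close> identifies the sphere with
  \<open>\<real>\<^sup>n \<union> {\<infinity>}\<close>, the base point being \<open>\<infinity>\<close>. There \<open>shift\<close> is the translation by minus the first
  unit vector, and \<open>pinch\<close> restricted to \<open>x 1 > 0\<close> becomes the central projection
  \<open>x \<mapsto> (x 0 / x 1, x 2 / x 1, \<dots>)\<close>.
\<close>

definition shift :: "(nat \<Rightarrow> real) \<Rightarrow> nat \<Rightarrow> real"
  where "shift x = (\<lambda>i. (if i = 0 then 1 + x 0 - 2 * x 1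
     else if i = 1 then 2 * (x 1 - 1 + x 0) else 2 * x i) / (3 - x 0 - 2 * x 1))"

lemma usphere_disc:
  assumes "x \<in> usphere n" "n \<ge> 1"
  shows "(x 0)\<^sup>2 + (x 1)\<^sup>2 \<le> 1"
proof -
  have "0 \<le> (\<Sum>i=2..n. (x i)\<^sup>2)" by (simp add: sum_nonneg)
  then show ?thesis using usphere_sum2[OF assms] by simp
qed

text \<open>For a the stereographic image of \<open>x\<close> and e the first unit vector, the
  denominator is \<open>1 - x 0\<close> times |a - e|^2 + 1. It is positive at the base point as
  well: the maximum of \<open>x 0 + 2 * x 1\<close> on the unit disc is the square root of 5, below
  3.\<close>

lemma shift_denom_pos:
  assumes "x \<in> usphere n" "n \<ge> 1"
  shows "0 < 3 - x 0 - 2 * x 1"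
proof -
  have "2 * x i \<le> (x i)\<^sup>2 + 1" for i
    using zero_le_power2[of "x i - 1"] by (simp add: power2_diff)
  from this[of 0] this[of 1] show ?thesis
    using usphere_disc[OF assms] zero_le_power2[of "x 0"] by linarith
qed

lemma minus_one_less_divide: "0 < d \<Longrightarrow> 0 < a + d \<Longrightarrow> - 1 < a / d" for a d :: real
  by (simp add: field_simps)

lemma shift_in_usphere:
  assumes x: "x \<in> usphere n" and n: "n \<ge> 1"
  shows "shift x \<in> usphere n"
proof (rule usphereI2[OF n])
  define d where "d = 3 - x 0 - 2 * x 1"
  have d: "d > 0" using shift_denom_pos[OF assms] by (simp add: d_def)
  have e: "shift x 0 = (1 + x 0 - 2 * x 1) / d" "shift x 1 = 2 * (x 1 - 1 + x 0) / d"
    by (simp_all add: shift_def d_def)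
  have "(\<Sum>i=2..n. (shift x i)\<^sup>2) = (\<Sum>i=2..n. 4 * (x i)\<^sup>2 / d\<^sup>2)"
    by (intro sum.cong) (auto simp: shift_def d_def power_divide)
  also have "\<dots> = 4 * (1 - (x 0)\<^sup>2 - (x 1)\<^sup>2) / d\<^sup>2"
    by (simp add: usphere_sum2[OF assms] sum_divide_distrib[symmetric] sum_distrib_left[symmetric])
  finally have "(shift x 0)\<^sup>2 + (shift x 1)\<^sup>2 + (\<Sum>i=2..n. (shift x i)\<^sup>2)
    = ((1 + x 0 - 2 * x 1)\<^sup>2 + (2 * (x 1 - 1 + x 0))\<^sup>2 + 4 * (1 - (x 0)\<^sup>2 - (x 1)\<^sup>2)) / d\<^sup>2"
    by (simp only: e power_divide add_divide_distrib)
  also have "(1 + x 0 - 2 * x 1)\<^sup>2 + (2 * (x 1 - 1 + x 0))\<^sup>2 + 4 * (1 - (x 0)\<^sup>2 - (x 1)\<^sup>2) = d\<^sup>2"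
    by (simp add: d_def power2_eq_square algebra_simps)
  finally show "(shift x 0)\<^sup>2 + (shift x 1)\<^sup>2 + (\<Sum>i=2..n. (shift x i)\<^sup>2) = 1"
    using d by simp
  show "shift x i = 0" if "i > n" for i
    using that n usphere_zero[OF x that] by (simp add: shift_def)
qed

lemma shift_pointed:
  assumes n: "n \<ge> 1" shows "shift \<in> pointed_maps n n"
  unfolding pointed_maps_iff
proof (intro conjI)
  have "continuous_on (usphere n) (\<lambda>x. shift x i)" for i
    unfolding shift_def
    by (cases "i = 0"; cases "i = 1")
      (auto intro!: continuous_intros continuous_on_coord_id dest: shift_denom_pos[OF _ n])
  then show "continuous_on (usphere n) shift"
    by (intro continuous_on_coordinatewise_then_product)
  show "shift ` usphere n \<subseteq> usphere n"
    using shift_in_usphere n by auto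
  show "shift base_pt = base_pt"
    by (rule ext) (auto simp: shift_def base_pt_def)
qed

text \<open>In stereographic coordinates \<open>x 0 \<ge> 0\<close> says |a| >= 1, and a point with
  nonpositive first coordinate has distance at least 1 from the first unit vector.\<close>

lemma shift_coord0_nonneg:
  assumes "x \<in> usphere n" "n \<ge> 1" "x 1 \<le> 0"
  shows "0 \<le> shift x 0"
  using shift_denom_pos[OF assms(1,2)] usphere_coord_le[OF assms(1), of 0] assms(3)
  by (simp add: shift_def)

lemma shift_id_not_antipodal:
  assumes x: "x \<in> usphere n" and n: "n \<ge> 1"
  shows "- 1 < (\<Sum>j\<le>n. shift x j * x j)"
proof -
  define d where "d = 3 - x 0 - 2 * x 1"
  have d: "d > 0" using shift_denom_pos[OF assms] by (simp add: d_def)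
  have e: "shift x 0 = (1 + x 0 - 2 * x 1) / d" "shift x 1 = 2 * (x 1 - 1 + x 0) / d"
    by (simp_all add: shift_def d_def)
  have "(\<Sum>i=2..n. shift x i * x i) = (\<Sum>i=2..n. 2 * (x i)\<^sup>2 / d)"
    by (intro sum.cong) (auto simp: shift_def d_def power2_eq_square)
  also have "\<dots> = 2 * (1 - (x 0)\<^sup>2 - (x 1)\<^sup>2) / d"
    by (simp add: usphere_sum2[OF assms] sum_divide_distrib[symmetric] sum_distrib_left[symmetric])
  finally have "(\<Sum>j\<le>n. shift x j * x j) =
    ((1 + x 0 - 2 * x 1) * x 0 + 2 * (x 1 - 1 + x 0) * x 1 + 2 * (1 - (x 0)\<^sup>2 - (x 1)\<^sup>2)) / d"
    unfolding sum_atMost_split2[OF n] by (simp only: e add_divide_distrib times_divide_eq_left)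
  moreover have "0 < ((1 + x 0 - 2 * x 1) * x 0 + 2 * (x 1 - 1 + x 0) * x 1 
    + 2 * (1 - (x 0)\<^sup>2 - (x 1)\<^sup>2)) + d"
  proof -
    \<comment> \<open>Numerator plus denominator equals
      \<open>(2 - x 1)\<^sup>2 + (1 - (x 0)\<^sup>2 - (x 1)\<^sup>2)\<close>.\<close>
    have "0 < (2 - x 1)\<^sup>2" using usphere_coord_le[OF x, of 1] by simp
    then show ?thesis
      using usphere_disc[OF assms] by (simp add: d_def power2_eq_square algebra_simps)
  qed
  ultimately show ?thesis using minus_one_less_divide[OF d] by presburger
qed

lemma shift_pinch_not_antipodal:
  assumes x: "x \<in> usphere n" and n: "n \<ge> 1" and x1: "x 1 \<ge> 0"
  shows "- 1 < (\<Sum>j\<le>n. shift x j * pinch x j)"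
proof -
  define d where "d = 3 - x 0 - 2 * x 1"
  have d: "d > 0" using shift_denom_pos[OF x n] by (simp add: d_def)
  have e: "shift x 0 = (1 + x 0 - 2 * x 1) / d" "shift x 1 = 2 * (x 1 - 1 + x 0) / d"
    by (simp_all add: shift_def d_def)
  have p: "pinch x 0 = 1 - 2 * (x 1)\<^sup>2" "pinch x 1 = 2 * x 1 * x 0"
    by (simp_all add: pinch_def)
  have "(\<Sum>i=2..n. shift x i * pinch x i) = (\<Sum>i=2..n. 4 * x 1 * (x i)\<^sup>2 / d)"
    using x1 by (intro sum.cong) (auto simp: shift_def pinch_def d_def power2_eq_square)
  also have "\<dots> = 4 * x 1 * (1 - (x 0)\<^sup>2 - (x 1)\<^sup>2) / d"
    by (simp add: usphere_sum2[OF x n] sum_divide_distrib[symmetric] sum_distrib_left[symmetric])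
  finally have "(\<Sum>j\<le>n. shift x j * pinch x j) =
    ((1 + x 0 - 2 * x 1) * (1 - 2 * (x 1)\<^sup>2) + 2 * (x 1 - 1 + x 0) * (2 * x 1 * x 0)
       + 4 * x 1 * (1 - (x 0)\<^sup>2 - (x 1)\<^sup>2)) / d"
    unfolding sum_atMost_split2[OF n] by (simp only: e p add_divide_distrib times_divide_eq_left)
  moreover have "0 < ((1 + x 0 - 2 * x 1) * (1 - 2 * (x 1)\<^sup>2) + 2 * (x 1 - 1 + x 0) * (2 * x 1 * x 0)
       + 4 * x 1 * (1 - (x 0)\<^sup>2 - (x 1)\<^sup>2)) + d"
  proof -
    \<comment> \<open>The right-hand side is numerator plus denominator, expanded.\<close>
    have "0 < 4 - 4 * x 0 * x 1 - 2 * (x 1)\<^sup>2 * (1 - x 0)"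
    proof (cases "x 0 \<ge> 0")
      case True
      then have "0 \<le> x 0 * (x 1)\<^sup>2" by simp
      \<comment> \<open>The weights 8 and 5 bound 4 x0 x1 by 3.2 x0^2 + 1.25 x1^2; together with the
        term 2 x1^2 this is at most 3.25 < 4 on the unit disc.\<close>
      moreover have "80 * (x 0 * x 1) \<le> 64 * (x 0)\<^sup>2 + 25 * (x 1)\<^sup>2"
        using zero_le_power2[of "8 * x 0 - 5 * x 1"] by (simp add: power2_diff power_mult_distrib)
      moreover have "4 - 4 * x 0 * x 1 - 2 * (x 1)\<^sup>2 * (1 - x 0)
          = 4 - 4 * (x 0 * x 1) - 2 * (x 1)\<^sup>2 + 2 * (x 0 * (x 1)\<^sup>2)"
        by (simp add: algebra_simps)
      ultimately show ?thesis
        using usphere_disc[OF x n] zero_le_power2[of "x 0"] zero_le_power2[of "x 1"] by linarith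
    next
      case False
      \<comment> \<open>Here \<open>x 0 * x 1 \<le> 0\<close>, so it is enough to bound
        \<open>(x 1)\<^sup>2 * (1 - x 0)\<close> strictly by 2.\<close>
      have "(x 1)\<^sup>2 * (1 - x 0) \<le> (1 - (x 0)\<^sup>2) * (1 - x 0)"
        using usphere_disc[OF x n] False by (intro mult_right_mono) auto
      also have "\<dots> = 2 - (1 + x 0) - (x 0)\<^sup>2 * (1 - x 0)"
        by (simp add: power2_eq_square algebra_simps)
      also have "\<dots> < 2"
      proof -
        have "0 < (x 0)\<^sup>2 * (1 - x 0)" using False by simp
        then show ?thesis using usphere_coord_le[OF x, of 0] by linarith
      qed
      finally show ?thesis
        using mult_nonpos_nonneg[of "x 0" "x 1"] False x1 by linarith
    qed
    then show ?thesis
      by (simp add: d_def power2_eq_square algebra_simps)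
  qed
  ultimately show ?thesis using minus_one_less_divide[OF d] by presburger
qed

section \<open>The homotopy group is a group\<close>

abbreviation const_base :: "(nat \<Rightarrow> real) \<Rightarrow> nat \<Rightarrow> real"
  where "const_base \<equiv> \<lambda>x. base_pt"

definition reflect1 :: "(nat \<Rightarrow> real) \<Rightarrow> nat \<Rightarrow> real"
  where "reflect1 x = (\<lambda>i. if i = 1 then - x i else x i)"

lemma reflect1_reflect1 [simp]: "reflect1 (reflect1 x) = x"
  by (auto simp: reflect1_def)

lemma reflect1_base_pt [simp]: "reflect1 base_pt = base_pt"
  by (auto simp: reflect1_def base_pt_def)

lemma reflect1_pointed [simp]: "reflect1 \<in> pointed_maps n n"
  using continuous_map_nsphere_reflection[of n 1] reflect1_base_pt
  by (simp add: pointed_maps_def reflect1_def[abs_def])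

lemma pinch_reflect1: "pinch (reflect1 x) = reflect1 (pinch x)"
  by (auto simp: pinch_def reflect1_def)

lemma sphere_mult_base_pt [simp]:
  "f base_pt = base_pt \<Longrightarrow> sphere_mult f g base_pt = base_pt"
  by (simp add: sphere_mult_def pinch_equator)

lemma sphere_mult_const_right:
  "f \<in> pointed_maps n k \<Longrightarrow> sphere_mult f const_base = f \<circ> sphere_mult id const_base"
  by (auto simp: sphere_mult_def pointed_maps_base)

text \<open>\<open>reflect1\<close> swaps the hemispheres and commutes with \<open>pinch\<close>, so
  facts about the first summand carry over to the second. On the equator both sides are
  \<open>base_pt\<close>.\<close>

lemma sphere_mult_const_left:
  assumes "f \<in> pointed_maps n k"
  shows "sphere_mult const_base f = sphere_mult (f \<circ> reflect1) const_base \<circ> reflect1"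
proof
  fix x :: "nat \<Rightarrow> real"
  consider "x 1 > 0" | "x 1 = 0" | "x 1 < 0" by linarith
  then show "sphere_mult const_base f x = (sphere_mult (f \<circ> reflect1) const_base \<circ> reflect1) x"
    using pointed_maps_base[OF assms] pinch_equator[of x]
    by cases (auto simp: sphere_mult_def pinch_reflect1, auto simp: reflect1_def)
qed

lemma sum_mult_base_pt: "(\<Sum>j\<le>n. v j * base_pt j) = (v 0 :: real)"
  unfolding sum_atMost_split1 by simp

lemma shift_sphere_mult_not_antipodal:
  assumes x: "x \<in> usphere n" and n: "n \<ge> 1"
  shows "- 1 < (\<Sum>j\<le>n. shift x j * sphere_mult id const_base x j)"
proof (cases "x 1 \<ge> 0")
  case True
  then show ?thesis using shift_pinch_not_antipodal[OF x n] by (simp add: sphere_mult_def)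
next
  case False
  then show ?thesis
    using shift_coord0_nonneg[OF x n] by (simp add: sphere_mult_def sum_mult_base_pt)
qed

lemma sphere_mult_id_const_shift:
  assumes n: "n \<ge> 1"
  shows "(shift, sphere_mult id const_base) \<in> pointed_homotopy n n"
proof (rule pointed_homotopy_great_arc[OF _ _ shift_sphere_mult_not_antipodal[OF _ n]])
qed (intro shift_pointed sphere_mult_pointed id_pointed const_pointed n)+

lemma shift_homotopic_id:
  "n \<ge> 1 \<Longrightarrow> (shift, id) \<in> pointed_homotopy n n"
  by (rule pointed_homotopy_great_arc) (simp_all add: shift_pointed shift_id_not_antipodal)

text \<open>Great arcs cannot join \<open>sphere_mult id const_base\<close> to \<open>id\<close>
  directly: at the antipode of \<open>base_pt\<close>, which lies on the equator, their values are
  opposite. The map \<open>shift\<close> is nowhere antipodal to either and serves as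
  intermediate.\<close>

lemma sphere_mult_right_unit:
  assumes n: "n \<ge> 1" and f: "f \<in> pointed_maps n k"
  shows "(sphere_mult f const_base, f) \<in> pointed_homotopy n k"
proof -
  have "(sphere_mult id const_base, id) \<in> pointed_homotopy n n"
    using sphere_mult_id_const_shift[OF n] shift_homotopic_id[OF n]
    by (blast intro: pointed_homotopy_sym pointed_homotopy_trans)
  from pointed_homotopy_comp_left[OF this f] show ?thesis
    by (simp add: sphere_mult_const_right[OF f])
qed

lemma sphere_mult_left_unit:
  assumes n: "n \<ge> 1" and f: "f \<in> pointed_maps n k"
  shows "(sphere_mult const_base f, f) \<in> pointed_homotopy n k"
proof -
  have "(sphere_mult (f \<circ> reflect1) const_base, f \<circ> reflect1) \<in> pointed_homotopy n k"
    by (rule sphere_mult_right_unit[OF n pointed_maps_comp[OF f reflect1_pointed]])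
  from pointed_homotopy_comp_right[OF this reflect1_pointed] show ?thesis
    by (simp add: sphere_mult_const_left[OF f] o_def)
qed

text \<open>
  The sum of \<open>f\<close> and \<open>f \<circ> reflect1\<close> factors through the upper hemisphere \<open>x 1 \<ge> 0\<close>. Dropping the
  coordinate \<open>x 1\<close> identifies this hemisphere with a disc, in which \<open>fold_hemisphere\<close> is the
  straight-line contraction to the base point.
\<close>

definition fold_hemisphere :: "real \<Rightarrow> (nat \<Rightarrow> real) \<Rightarrow> nat \<Rightarrow> real"
  where "fold_hemisphere t x = (\<lambda>i. if i = 1
    then sqrt (1 - ((1 - t)\<^sup>2 * (1 - (x 1)\<^sup>2) + 2 * t * (1 - t) * x 0 + t\<^sup>2))
    else (1 - t) * x i + t * base_pt i)"

lemma fold_hemisphere_in_usphere: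
  assumes x: "x \<in> usphere n" and n: "n \<ge> 1" and t: "t \<in> {0..1}"
  shows "fold_hemisphere t x \<in> usphere n"
proof (rule usphereI2[OF n])
  let ?y = "fold_hemisphere t x" and ?s = "(1 - t)\<^sup>2 * (1 - (x 1)\<^sup>2) + 2 * t * (1 - t) * x 0 + t\<^sup>2"
  \<comment> \<open>\<open>?s\<close> is the squared length of (1 - t) x' + t e, where x' is
    \<open>x\<close> without coordinate 1 and e is \<open>base_pt\<close>; it is at most 1 by
    convexity of the ball.\<close>
  have "(1 - t)\<^sup>2 * (1 - (x 1)\<^sup>2) \<le> (1 - t)\<^sup>2 * 1"
    by (intro mult_left_mono) auto
  moreover have "2 * t * (1 - t) * x 0 \<le> 2 * t * (1 - t) * 1"
    using t usphere_coord_le[OF x, of 0] by (intro mult_left_mono) auto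
  moreover have "(1 - t)\<^sup>2 * 1 + 2 * t * (1 - t) * 1 + t\<^sup>2 = 1"
    by (simp add: power2_eq_square algebra_simps)
  ultimately have "0 \<le> 1 - ?s" by linarith
  then have y1: "(?y 1)\<^sup>2 = 1 - ?s" by (simp add: fold_hemisphere_def)
  have "(\<Sum>i=2..n. (?y i)\<^sup>2) = (\<Sum>i=2..n. (1 - t)\<^sup>2 * (x i)\<^sup>2)"
    by (intro sum.cong) (auto simp: fold_hemisphere_def power_mult_distrib)
  also have "\<dots> = (1 - t)\<^sup>2 * (1 - (x 0)\<^sup>2 - (x 1)\<^sup>2)"
    by (simp add: usphere_sum2[OF x n] sum_distrib_left[symmetric])
  finally show "(?y 0)\<^sup>2 + (?y 1)\<^sup>2 + (\<Sum>i=2..n. (?y i)\<^sup>2) = 1"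
    unfolding y1 by (simp add: fold_hemisphere_def power2_eq_square algebra_simps)
  show "?y i = 0" if "i > n" for i
    using that n usphere_zero[OF x that] by (simp add: fold_hemisphere_def)
qed

lemma continuous_on_fold_hemisphere:
  "continuous_on S (\<lambda>z. fold_hemisphere (fst z) (snd z))"
proof -
  have "continuous_on S (\<lambda>z. fold_hemisphere (fst z) (snd z) i)" for i
    unfolding fold_hemisphere_def
    by (cases "i = 1") (auto intro!: continuous_intros continuous_on_coord_snd)
  then show ?thesis by (intro continuous_on_coordinatewise_then_product)
qed

lemma sphere_mult_right_inverse:
  assumes n: "n \<ge> 1" and f: "f \<in> pointed_maps n k"
  shows "(sphere_mult f (f \<circ> reflect1), const_base) \<in> pointed_homotopy n k"
proof (rule pointed_homotopyI)
  let ?H = "\<lambda>z. f (pinch (fold_hemisphere (fst z) (snd z)))"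
  have fp: "f \<circ> pinch \<in> pointed_maps n k"
    by (rule pointed_maps_comp[OF f pinch_pointed[OF n]])
  have "continuous_on ({0..1} \<times> usphere n) (\<lambda>z. (f \<circ> pinch) (fold_hemisphere (fst z) (snd z)))"
    by (rule continuous_on_compose2[OF _ continuous_on_fold_hemisphere, of "usphere n"])
      (use fp fold_hemisphere_in_usphere[OF _ n] in \<open>auto simp: pointed_maps_iff\<close>)
  then show "continuous_on ({0..1} \<times> usphere n) ?H" by simp
  show "?H (t, x) \<in> usphere k" if "t \<in> {0..1}" "x \<in> usphere n" for t x
    using pointed_maps_in[OF fp fold_hemisphere_in_usphere[OF that(2) n that(1)]] by simp
  have "fold_hemisphere t base_pt 1 = 0" for t
    by (simp add: fold_hemisphere_def power2_eq_square algebra_simps)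
  then show "?H (t, base_pt) = base_pt" for t
    by (simp add: pinch_equator pointed_maps_base[OF f])
  have "fold_hemisphere 1 x 1 = 0" for x
    by (simp add: fold_hemisphere_def)
  then show "?H (1, x) = base_pt" for x
    by (simp add: pinch_equator pointed_maps_base[OF f])
  \<comment> \<open>At \<open>t = 0\<close> the square root is \<open>\<bar>x 1\<bar>\<close>, so
    the contraction starts at the fold of the lower hemisphere onto the upper one.\<close>
  have "fold_hemisphere 0 x = (if x 1 \<ge> 0 then x else reflect1 x)" for x
    by (auto simp: fold_hemisphere_def reflect1_def)
  then show "?H (0, x) = sphere_mult f (f \<circ> reflect1) x" for x
    by (simp add: sphere_mult_def pinch_reflect1)
qed

section \<open>Associativity by way of four quarters\<close>

lemma not_antipodalI:
  assumes u: "u \<in> usphere n" and v: "v \<in> usphere n"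
    and ne: "\<not> (\<forall>i\<le>n. u i + v i = 0)"
  shows "- 1 < (\<Sum>j\<le>n. u j * v j)"
proof (rule ccontr)
  assume le: "\<not> - 1 < (\<Sum>j\<le>n. u j * v j)"
  \<comment> \<open>|u + v|^2 = 2 + 2 <u, v>, so an inner product of at most -1 forces u =
    -v.\<close>
  have "(\<Sum>j\<le>n. (u j + v j)\<^sup>2) = (\<Sum>j\<le>n. (u j)\<^sup>2 + (v j)\<^sup>2 + 2 * (u j * v j))"
    by (intro sum.cong) (auto simp: power2_sum)
  also have "\<dots> = 2 + 2 * (\<Sum>j\<le>n. u j * v j)"
    using u v by (simp add: sum.distrib sum_distrib_left usphere_def)
  finally have "(\<Sum>j\<le>n. (u j + v j)\<^sup>2) \<le> 0" using le by simp
  then have "(\<Sum>j\<le>n. (u j + v j)\<^sup>2) = 0"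
    by (intro antisym sum_nonneg) auto
  then show False using ne by (simp add: sum_nonneg_eq_0_iff)
qed

definition rotate01 :: "real \<Rightarrow> (nat \<Rightarrow> real) \<Rightarrow> nat \<Rightarrow> real"
  where "rotate01 t x = (\<lambda>i. if i = 0 then cos (pi / 2 * t) * x 0 + sin (pi / 2 * t) * x 1
     else if i = 1 then cos (pi / 2 * t) * x 1 - sin (pi / 2 * t) * x 0 else x i)"

lemma rotate01_in_usphere:
  assumes x: "x \<in> usphere n" and n: "n \<ge> 1"
  shows "rotate01 t x \<in> usphere n"
proof (rule usphereI2[OF n])
  define c s where "c = cos (pi / 2 * t)" and "s = sin (pi / 2 * t)"
  have "(\<Sum>i=2..n. (rotate01 t x i)\<^sup>2) = (\<Sum>i=2..n. (x i)\<^sup>2)"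
    by (intro sum.cong) (auto simp: rotate01_def)
  moreover have "(rotate01 t x 0)\<^sup>2 + (rotate01 t x 1)\<^sup>2 = (c\<^sup>2 + s\<^sup>2) * ((x 0)\<^sup>2 + (x 1)\<^sup>2)"
  proof -
    have "rotate01 t x 0 = c * x 0 + s * x 1" "rotate01 t x 1 = c * x 1 - s * x 0"
      by (simp_all add: rotate01_def c_def s_def)
    then show ?thesis by (simp only:) (simp add: power2_eq_square algebra_simps)
  qed
  moreover have "c\<^sup>2 + s\<^sup>2 = 1" by (simp add: c_def s_def)
  ultimately show "(rotate01 t x 0)\<^sup>2 + (rotate01 t x 1)\<^sup>2 + (\<Sum>i=2..n. (rotate01 t x i)\<^sup>2) = 1"
    by (simp add: usphere_sum2[OF x n])
  show "rotate01 t x i = 0" if "i > n" for i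
    using that n usphere_zero[OF x that] by (simp add: rotate01_def)
qed

lemma continuous_on_rotate01: "continuous_on S (\<lambda>z. rotate01 (fst z) (snd z))"
proof -
  have "continuous_on S (\<lambda>z. rotate01 (fst z) (snd z) i)" for i
    unfolding rotate01_def
    by (cases "i = 0"; cases "i = 1") (auto intro!: continuous_intros continuous_on_coord_snd)
  then show ?thesis by (intro continuous_on_coordinatewise_then_product)
qed

text \<open>
  Associativity reduces to moving \<open>g\<close> from the second to the third of the four quarters cut out by
  \<open>x 0 = 0\<close> and \<open>x 1 = 0\<close>: a quarter turn does this within the half \<open>x 0 \<le> 0\<close>, up to a great circle
  homotopy.
\<close>

abbreviation "quarter2 \<equiv> sphere_mult (sphere_mult const_base id) const_base"
abbreviation "quarter3 \<equiv> sphere_mult const_base (sphere_mult id const_base)"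

text \<open>\<open>pinch x 1\<close> has the sign of \<open>x 0 * x 1\<close>, so the nested case
  distinctions select one quarter; pinching twice collapses the walls \<open>x 0 = 0\<close> and
  \<open>x 1 = 0\<close> to \<open>base_pt\<close>.\<close>

lemma quarter2_eq: "quarter2 x = (if x 0 < 0 \<and> x 1 > 0 then pinch (pinch x) else base_pt)"
  and quarter3_eq: "quarter3 x = (if x 0 < 0 \<and> x 1 < 0 then pinch (pinch x) else base_pt)"
proof -
  have "pinch x (Suc 0) = 2 * x (Suc 0) * x 0" by (simp add: pinch_def)
  then show "quarter2 x = (if x 0 < 0 \<and> x 1 > 0 then pinch (pinch x) else base_pt)"
    "quarter3 x = (if x 0 < 0 \<and> x 1 < 0 then pinch (pinch x) else base_pt)"
    using pinch_equator[of "pinch x"]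
    by (auto simp: sphere_mult_def mult_less_0_iff zero_le_mult_iff not_less not_le)
qed

lemma pinch_pinch:
  "pinch (pinch x) = (\<lambda>i. if i = 0 then 1 - 8 * (x 0)\<^sup>2 * (x 1)\<^sup>2
     else if i = 1 then 4 * x 0 * x 1 * (1 - 2 * (x 1)\<^sup>2)
     else 8 * (x 1)\<^sup>2 * \<bar>x 0\<bar> * x i)"
  by (rule ext) (auto simp: pinch_def power2_eq_square abs_mult)

lemma quarter2_pointed: "n \<ge> 1 \<Longrightarrow> quarter2 \<in> pointed_maps n n"
  and quarter3_pointed: "n \<ge> 1 \<Longrightarrow> quarter3 \<in> pointed_maps n n"
  by (intro sphere_mult_pointed; simp)+

text \<open>Pasting along the wall \<open>x 0 = 0\<close>, where \<open>g \<circ> K\<close> and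
  \<open>e\<close> are both \<open>base_pt\<close>. The homotopy moves only the half
  \<open>x 0 \<le> 0\<close>, which does not contain the base point.\<close>

lemma glue_left_half:
  assumes K: "continuous_on ({0..1::real} \<times> usphere n) K"
    and K_in: "\<And>t x. t \<in> {0..1} \<Longrightarrow> x \<in> usphere n \<Longrightarrow> K (t, x) \<in> usphere n"
    and K_base: "\<And>t x. t \<in> {0..1} \<Longrightarrow> x \<in> usphere n \<Longrightarrow> x 0 \<ge> 0 \<Longrightarrow> K (t, x) = base_pt"
    and g: "g \<in> pointed_maps n k" and e: "e \<in> pointed_maps n k"
    and e_base: "\<And>x. x \<in> usphere n \<Longrightarrow> x 0 = 0 \<Longrightarrow> e x = base_pt"
    and p: "\<And>x. x \<in> usphere n \<Longrightarrow> p x = (if x 0 \<le> 0 then g (K (0, x)) else e x)"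
    and q: "\<And>x. x \<in> usphere n \<Longrightarrow> q x = (if x 0 \<le> 0 then g (K (1, x)) else e x)"
  shows "(p, q) \<in> pointed_homotopy n k"
proof (rule pointed_homotopyI)
  let ?S = "{0..1::real} \<times> usphere n"
  let ?H = "\<lambda>z. if snd z 0 \<le> 0 then g (K z) else e (snd z)"
  have "continuous_on ?S (\<lambda>z. g (K z))"
    by (rule continuous_on_compose2[OF _ K, of "usphere n"]) (use g K_in in \<open>auto simp: pointed_maps_iff\<close>)
  moreover have "continuous_on ?S (\<lambda>z. e (snd z))"
    by (rule continuous_on_pointed_snd[OF e])
  ultimately show "continuous_on ?S ?H"
    by (intro continuous_on_cases_le continuous_on_coord_snd)
      (auto intro: continuous_on_subset simp: K_base e_base pointed_maps_base[OF g])
  show "?H (t, x) \<in> usphere k" if "t \<in> {0..1}" "x \<in> usphere n" for t x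
    using that K_in pointed_maps_in[OF g] pointed_maps_in[OF e] by auto
  show "?H (t, base_pt) = base_pt" if "t \<in> {0..1}" for t
    by (simp add: pointed_maps_base[OF e])
qed (simp_all add: p q)

lemma sphere_mult_interchange:
  assumes n: "n \<ge> 1"
    and f: "f \<in> pointed_maps n k" and g: "g \<in> pointed_maps n k" and h: "h \<in> pointed_maps n k"
  shows "(sphere_mult (sphere_mult f g) (sphere_mult const_base h),
          sphere_mult (sphere_mult f const_base) (sphere_mult g h)) \<in> pointed_homotopy n k"
proof -
  \<comment> \<open>The part common to both sides: \<open>f\<close> in the first quarter,
    \<open>h\<close> in the fourth, constant in between.\<close>
  define e where "e = sphere_mult (sphere_mult f const_base) (sphere_mult const_base h)"
  have e: "e \<in> pointed_maps n k"
    unfolding e_def by (intro sphere_mult_pointed n f h const_pointed)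
  note base = pointed_maps_base[OF f] pointed_maps_base[OF g] pointed_maps_base[OF h]
  have pinch1: "pinch x (Suc 0) = 2 * x (Suc 0) * x 0" for x by (simp add: pinch_def)
  have e_base: "e x = base_pt" if "x 0 = 0" for x
    using that pinch_equator[of "pinch x"] by (auto simp: e_def sphere_mult_def pinch1 base)
  \<comment> \<open>Halfway stage: the turn has brought \<open>g\<close> into the third quarter,
    still in rotated coordinates.\<close>
  let ?m = "\<lambda>x. if x 0 \<le> 0 then g (quarter2 (rotate01 1 x)) else e x"
  have rot1: "rotate01 1 x = (\<lambda>i. if i = 0 then x 1 else if i = 1 then - x 0 else x i)" for x
    by (auto simp: rotate01_def)
  have "(sphere_mult (sphere_mult f g) (sphere_mult const_base h), ?m) \<in> pointed_homotopy n k"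
  proof (rule glue_left_half[where K = "\<lambda>z. quarter2 (rotate01 (fst z) (snd z))" and g = g and e = e])
    show "continuous_on ({0..1} \<times> usphere n) (\<lambda>z. quarter2 (rotate01 (fst z) (snd z)))"
    proof (rule continuous_on_compose2[OF _ continuous_on_rotate01])
      show "continuous_on (usphere n) quarter2"
        using quarter2_pointed[OF n] unfolding pointed_maps_iff by blast
    qed (use rotate01_in_usphere[OF _ n] in auto)
    show "quarter2 (rotate01 (fst (t, x)) (snd (t, x))) \<in> usphere n" if "x \<in> usphere n" for t x
      using pointed_maps_in[OF quarter2_pointed[OF n] rotate01_in_usphere[OF that n]] by simp
    show "quarter2 (rotate01 (fst (t, x)) (snd (t, x))) = base_pt" if "t \<in> {0..1}" "x 0 \<ge> 0" for t x
    proof -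
      define c s where "c = cos (pi / 2 * t)" and "s = sin (pi / 2 * t)"
      have "0 \<le> pi / 2 * t" "pi / 2 * t \<le> pi / 2" using that(1) by (auto simp: mult_left_le)
      then have cs: "c \<ge> 0" "s \<ge> 0"
        using cos_ge_zero[of "pi / 2 * t"] sin_ge_zero[of "pi / 2 * t"] by (auto simp: c_def s_def)
      \<comment> \<open>A clockwise turn by at most a right angle reaches the open second quarter
        only from angles between pi/2 and 3 pi/2, that is, from \<open>x 0 < 0\<close>.\<close>
      have "\<not> (c * x 0 + s * x 1 < 0 \<and> c * x 1 - s * x 0 > 0)"
      proof (cases "x 1 \<ge> 0")
        case True
        then have "0 \<le> c * x 0 + s * x 1" using cs that(2) by simp
        then show ?thesis by simp
      next
        case False
        then have "c * x 1 \<le> 0" "0 \<le> s * x 0" using cs that(2) by (auto simp: mult_nonneg_nonpos)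
        then show ?thesis by simp
      qed
      then have "\<not> (rotate01 t x 0 < 0 \<and> rotate01 t x 1 > 0)"
        by (simp add: rotate01_def c_def s_def)
      then show ?thesis unfolding fst_conv snd_conv quarter2_eq by (rule if_not_P)
    qed
    show "sphere_mult (sphere_mult f g) (sphere_mult const_base h) x =
        (if x 0 \<le> 0 then g (quarter2 (rotate01 (fst (0, x)) (snd (0, x)))) else e x)" for x
    proof -
      have "rotate01 0 x = x" by (auto simp: rotate01_def)
      then show ?thesis
        using pinch_equator[of "pinch x"]
        by (auto simp: quarter2_eq e_def sphere_mult_def pinch1 base mult_less_0_iff
            zero_le_mult_iff not_less not_le)
    qed
  qed (auto simp: g e e_base)
  also have "(?m, sphere_mult (sphere_mult f const_base) (sphere_mult g h)) \<in> pointed_homotopy n k"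
  proof (rule glue_left_half[where K = "\<lambda>(t, x). great_arc n t (quarter2 (rotate01 1 x)) (quarter3 x)"
        and g = g and e = e])
    have r1: "rotate01 1 x \<in> usphere n" if "x \<in> usphere n" for x
      by (rule rotate01_in_usphere[OF that n])
    have c1: "quarter2 (rotate01 1 x) \<in> usphere n" if "x \<in> usphere n" for x
      using pointed_maps_in[OF quarter2_pointed[OF n] r1[OF that]] .
    have c2: "quarter3 x \<in> usphere n" if "x \<in> usphere n" for x
      using pointed_maps_in[OF quarter3_pointed[OF n] that] .
    have q21: "quarter2 \<circ> rotate01 1 \<in> pointed_maps n n"
      unfolding pointed_maps_iff
    proof (intro conjI)
      have "continuous_on (usphere n) (\<lambda>x. rotate01 1 x i)" for i
        unfolding rot1 by (cases "i = 0"; cases "i = 1")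
          (auto intro!: continuous_intros continuous_on_coord_id)
      then have "continuous_on (usphere n) (rotate01 1)"
        by (intro continuous_on_coordinatewise_then_product)
      then show "continuous_on (usphere n) (quarter2 \<circ> rotate01 1)"
        using r1 quarter2_pointed[OF n]
        by (intro continuous_on_compose) (auto simp: pointed_maps_iff intro: continuous_on_subset)
      show "(quarter2 \<circ> rotate01 1) base_pt = base_pt"
        by (simp add: quarter2_eq rot1)
    qed (use c1 in auto)
    \<comment> \<open>Outside the third quarter both maps are \<open>base_pt\<close>. Inside,
      opposite values force \<open>x i = 0\<close> for \<open>i \<ge> 2\<close>, because the two
      coefficients of \<open>x i\<close> have the same sign; then coordinate 1 forces x0^2 = x1^2 =
      1/2, and coordinate 0 becomes -1 for both maps, a contradiction.\<close>
    have ne: "- 1 < (\<Sum>j\<le>n. quarter2 (rotate01 1 x) j * quarter3 x j)" if x: "x \<in> usphere n" for x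
    proof (rule not_antipodalI[OF c1[OF x] c2[OF x]], rule notI)
      assume a: "\<forall>i\<le>n. quarter2 (rotate01 1 x) i + quarter3 x i = 0"
      show False
      proof (cases "x 0 < 0 \<and> x 1 < 0")
        case False
        then have "quarter2 (rotate01 1 x) 0 + quarter3 x 0 = 2"
          by (auto simp: quarter2_eq quarter3_eq rot1)
        then show False using a by simp
      next
        case True
        then have b: "pinch (pinch (rotate01 1 x)) i + pinch (pinch x) i = 0" if "i \<le> n" for i
          using a that by (auto simp: quarter2_eq quarter3_eq rot1)
        have "x i = 0" if i: "i \<in> {2..n}" for i
        proof -
          have "0 < (x 0)\<^sup>2 * \<bar>x 1\<bar> + (x 1)\<^sup>2 * \<bar>x 0\<bar>"
            using True by (intro add_pos_pos mult_pos_pos) auto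
          moreover have "((x 0)\<^sup>2 * \<bar>x 1\<bar> + (x 1)\<^sup>2 * \<bar>x 0\<bar>) * x i = 0"
            using b[of i] i unfolding pinch_pinch rot1 by (simp add: algebra_simps)
          ultimately show ?thesis by simp
        qed
        then have one: "(x 0)\<^sup>2 + (x 1)\<^sup>2 = 1"
          using usphere_sum2[OF x n] by simp
        have "x 0 * x 1 * ((x 0)\<^sup>2 - (x 1)\<^sup>2) = 0"
          using b[of 1] n unfolding pinch_pinch rot1 by (simp add: algebra_simps)
        then have "(x 0)\<^sup>2 = (x 1)\<^sup>2" using True by simp
        with one have half: "(x 0)\<^sup>2 = 1 / 2" "(x 1)\<^sup>2 = 1 / 2" by simp_all
        have "8 * (x 0)\<^sup>2 * (x 1)\<^sup>2 = 1"
          using b[of 0] unfolding pinch_pinch rot1 by simp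
        then show False unfolding half by simp
      qed
    qed
    show "continuous_on ({0..1} \<times> usphere n) (\<lambda>(t, x). great_arc n t (quarter2 (rotate01 1 x)) (quarter3 x))"
      using continuous_on_great_arc[OF q21 quarter3_pointed[OF n]] ne by simp
    show "(case (t, x) of (t, x) \<Rightarrow> great_arc n t (quarter2 (rotate01 1 x)) (quarter3 x)) \<in> usphere n"
      if "t \<in> {0..1}" "x \<in> usphere n" for t x
      using that by (simp add: great_arc_in_usphere c1 c2 ne)
    show "(case (t, x) of (t, x) \<Rightarrow> great_arc n t (quarter2 (rotate01 1 x)) (quarter3 x)) = base_pt"
      if "x 0 \<ge> 0" for t x
      using that by (simp add: quarter2_eq quarter3_eq rot1 great_arc_same)
    show "sphere_mult (sphere_mult f const_base) (sphere_mult g h) x =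
      (if x 0 \<le> 0 then g (case (1, x) of (t, x) \<Rightarrow> great_arc n t (quarter2 (rotate01 1 x)) (quarter3 x)) else e x)"
      if "x \<in> usphere n" for x
      unfolding prod.case great_arc_1[OF c2[OF that]] using pinch_equator[of "pinch x"]
      by (auto simp: quarter3_eq e_def sphere_mult_def pinch1 base mult_less_0_iff
            zero_le_mult_iff not_less not_le)
    show "?m x = (if x 0 \<le> 0 then g (case (0, x) of (t, x) \<Rightarrow> great_arc n t (quarter2 (rotate01 1 x)) (quarter3 x)) else e x)"
      if "x \<in> usphere n" for x
      unfolding prod.case great_arc_0[OF c1[OF that]] by simp
  qed (auto simp: g e e_base)
  finally show ?thesis .
qed

text \<open>Padding with \<open>const_base\<close> spreads the maps over the four quarters:
  \<open>f\<close>, \<open>g\<close>, constant, \<open>h\<close> for the left bracketing and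
  \<open>f\<close>, constant, \<open>g\<close>, \<open>h\<close> for the right one.\<close>

lemma sphere_mult_assoc:
  assumes n: "n \<ge> 1"
    and f: "f \<in> pointed_maps n k" and g: "g \<in> pointed_maps n k" and h: "h \<in> pointed_maps n k"
  shows "(sphere_mult (sphere_mult f g) h, sphere_mult f (sphere_mult g h)) \<in> pointed_homotopy n k"
proof -
  note refl = pointed_homotopy_refl[OF sphere_mult_pointed[OF n]]
  have "(sphere_mult (sphere_mult f g) h, sphere_mult (sphere_mult f g) (sphere_mult const_base h))
      \<in> pointed_homotopy n k"
    by (intro homotopic_sphere_mult n refl f g pointed_homotopy_sym[OF sphere_mult_left_unit[OF n h]])
  also have "(sphere_mult (sphere_mult f g) (sphere_mult const_base h),
      sphere_mult (sphere_mult f const_base) (sphere_mult g h)) \<in> pointed_homotopy n k"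
    by (rule sphere_mult_interchange[OF n f g h])
  also have "(sphere_mult (sphere_mult f const_base) (sphere_mult g h),
      sphere_mult f (sphere_mult g h)) \<in> pointed_homotopy n k"
    by (intro homotopic_sphere_mult n refl g h sphere_mult_right_unit[OF n f])
  finally show ?thesis .
qed

lemma sphere_mult_left_inverse:
  assumes n: "n \<ge> 1" and f: "f \<in> pointed_maps n k"
  shows "(sphere_mult (f \<circ> reflect1) f, const_base) \<in> pointed_homotopy n k"
  using sphere_mult_right_inverse[OF n pointed_maps_comp[OF f reflect1_pointed]]
  by (simp add: o_def)

section \<open>Group axioms on homotopy classes\<close>

lemma carrier_homotopy_group: "carrier (homotopy_group n k) = pointed_maps n k // pointed_homotopy n k"
  and one_homotopy_group: "\<one>\<^bsub>homotopy_group n k\<^esub> = pointed_homotopy n k `` {const_base}"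
  by (simp_all add: homotopy_group_def)

lemma homotopy_class_eq_iff:
  assumes "f \<in> pointed_maps n k" "g \<in> pointed_maps n k"
  shows "pointed_homotopy n k `` {f} = pointed_homotopy n k `` {g} \<longleftrightarrow> (f, g) \<in> pointed_homotopy n k"
  using eq_equiv_class_iff[OF equiv_pointed_homotopy assms] .

lemma homotopy_class_in_carrier:
  "f \<in> pointed_maps n k \<Longrightarrow> pointed_homotopy n k `` {f} \<in> carrier (homotopy_group n k)"
  by (simp add: carrier_homotopy_group quotientI)

lemma homotopy_group_carrierE:
  assumes "A \<in> carrier (homotopy_group n k)"
  obtains f where "f \<in> pointed_maps n k" "A = pointed_homotopy n k `` {f}"
  using assms by (auto simp: carrier_homotopy_group elim: quotientE)

lemma group_homotopy_group:
  assumes n: "n \<ge> 1"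
  shows "group (homotopy_group n k)"
proof (rule groupI)
  let ?G = "homotopy_group n k" and ?c = "\<lambda>f. pointed_homotopy n k `` {f}"
  note mult = homotopy_group_mult[OF n] and sm = sphere_mult_pointed[OF n]
  show "\<one>\<^bsub>?G\<^esub> \<in> carrier ?G"
    by (simp add: one_homotopy_group homotopy_class_in_carrier)
  show "A \<otimes>\<^bsub>?G\<^esub> B \<in> carrier ?G" if "A \<in> carrier ?G" "B \<in> carrier ?G" for A B
    using that by (elim homotopy_group_carrierE) (simp add: mult sm homotopy_class_in_carrier)
  show "A \<otimes>\<^bsub>?G\<^esub> B \<otimes>\<^bsub>?G\<^esub> C = A \<otimes>\<^bsub>?G\<^esub> (B \<otimes>\<^bsub>?G\<^esub> C)"
    if "A \<in> carrier ?G" "B \<in> carrier ?G" "C \<in> carrier ?G" for A B C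
    using that
    by (elim homotopy_group_carrierE) (simp add: mult sm homotopy_class_eq_iff sphere_mult_assoc[OF n])
  show "\<one>\<^bsub>?G\<^esub> \<otimes>\<^bsub>?G\<^esub> A = A" if "A \<in> carrier ?G" for A
    using that
    by (elim homotopy_group_carrierE)
      (simp add: one_homotopy_group mult sm homotopy_class_eq_iff sphere_mult_left_unit[OF n])
  show "\<exists>B\<in>carrier ?G. B \<otimes>\<^bsub>?G\<^esub> A = \<one>\<^bsub>?G\<^esub>" if A: "A \<in> carrier ?G" for A
  proof -
    obtain f where f: "f \<in> pointed_maps n k" "A = ?c f"
      by (rule homotopy_group_carrierE[OF A])
    have fr: "f \<circ> reflect1 \<in> pointed_maps n k"
      by (rule pointed_maps_comp[OF f(1) reflect1_pointed])
    have "?c (f \<circ> reflect1) \<otimes>\<^bsub>?G\<^esub> A = \<one>\<^bsub>?G\<^esub>"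
      using f fr sphere_mult_left_inverse[OF n f(1)]
      by (simp add: one_homotopy_group mult sm homotopy_class_eq_iff)
    then show ?thesis using homotopy_class_in_carrier[OF fr] by blast
  qed
qed

lemma inv_homotopy_group:
  assumes n: "n \<ge> 1" and f: "f \<in> pointed_maps n k"
  shows "inv\<^bsub>homotopy_group n k\<^esub> (pointed_homotopy n k `` {f}) = pointed_homotopy n k `` {f \<circ> reflect1}"
proof (rule group.inv_equality[OF group_homotopy_group[OF n]])
  have fr: "f \<circ> reflect1 \<in> pointed_maps n k"
    by (rule pointed_maps_comp[OF f reflect1_pointed])
  show "(pointed_homotopy n k `` {f \<circ> reflect1}) \<otimes>\<^bsub>homotopy_group n k\<^esub> (pointed_homotopy n k `` {f})
      = \<one>\<^bsub>homotopy_group n k\<^esub>"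
    using f fr sphere_mult_left_inverse[OF n f]
    by (simp add: one_homotopy_group homotopy_group_mult[OF n] sphere_mult_pointed[OF n]
        homotopy_class_eq_iff)
qed (use f pointed_maps_comp[OF f reflect1_pointed] in \<open>simp_all add: homotopy_class_in_carrier\<close>)

section \<open>Regular maps\<close>

text \<open>
  Addition in \<open>\<real>\<^sup>k \<union> {\<infinity>}\<close>, read on the sphere via stereographic projection from the antipode of
  the base point, which is \<open>\<infinity>\<close>, while the base point is \<open>0\<close>. Since translations are conformal,
  this is a regular map away from the single point \<open>(\<infinity>, \<infinity>)\<close>, the only zero of the denominator.
\<close>

definition sphere_add_denom :: "nat \<Rightarrow> (nat \<Rightarrow> real) \<Rightarrow> (nat \<Rightarrow> real) \<Rightarrow> real"
  where "sphere_add_denom k x y =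
    2 * (1 + x 0) + 2 * (1 + y 0) - (1 + x 0) * (1 + y 0) + 2 * (\<Sum>i=1..k. x i * y i)"

definition sphere_add :: "nat \<Rightarrow> (nat \<Rightarrow> real) \<Rightarrow> (nat \<Rightarrow> real) \<Rightarrow> nat \<Rightarrow> real"
  where "sphere_add k x y =
    (\<lambda>i. (if i = 0 then 2 * ((1 + x 0) * (1 + y 0)) - sphere_add_denom k x y
      else 2 * ((1 + y 0) * x i + (1 + x 0) * y i)) / sphere_add_denom k x y)"

text \<open>Put p = (1 + x0)(1 + y0) and let d be the denominator; for finite stereographic images
  a, b one has d = p (1 + |a + b|^2). The identity yields both p <= d and, through (2p - d)^2 + 4p(d
  - p) = d^2, that sums lie on the sphere.\<close>

lemma sum_cross_squares:
  assumes x: "x \<in> usphere k" and y: "y \<in> usphere k"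
  shows "(\<Sum>i=1..k. ((1 + y 0) * x i + (1 + x 0) * y i)\<^sup>2)
    = (1 + x 0) * (1 + y 0) * (sphere_add_denom k x y - (1 + x 0) * (1 + y 0))"
proof -
  have "(\<Sum>i=1..k. ((1 + y 0) * x i + (1 + x 0) * y i)\<^sup>2)
    = (\<Sum>i=1..k. (1 + y 0)\<^sup>2 * (x i)\<^sup>2 + (1 + x 0)\<^sup>2 * (y i)\<^sup>2 + 2 * (1 + x 0) * (1 + y 0) * (x i * y i))"
    by (intro sum.cong) (auto simp: power2_eq_square algebra_simps)
  also have "\<dots> = (1 + y 0)\<^sup>2 * (1 - (x 0)\<^sup>2) + (1 + x 0)\<^sup>2 * (1 - (y 0)\<^sup>2)
      + 2 * (1 + x 0) * (1 + y 0) * (\<Sum>i=1..k. x i * y i)"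
    by (simp only: sum.distrib sum_distrib_left[symmetric] usphere_sum1[OF x] usphere_sum1[OF y])
  finally show ?thesis
    by (simp add: sphere_add_denom_def power2_eq_square algebra_simps)
qed

lemma usphere_antipode:
  assumes "x \<in> usphere k" "x 0 = -1" "i \<noteq> 0" shows "x i = 0"
proof (cases "i \<le> k")
  case True
  have "(\<Sum>i=1..k. (x i)\<^sup>2) = 0"
    using usphere_sum1[OF assms(1)] assms(2) by simp
  then have "\<forall>i\<in>{1..k}. (x i)\<^sup>2 = 0"
    by (subst (asm) sum_nonneg_eq_0_iff) auto
  then show ?thesis using True assms(3) by auto
qed (use assms(1) in \<open>auto simp: usphere_def\<close>)

text \<open>If neither point is at infinity, \<open>sum_cross_squares\<close> gives d >= p > 0. If
  one is, that identity reads 0 = 0, but the inner product vanishes and d is twice 1 plus the zeroth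
  coordinate of the other point.\<close>

lemma sphere_add_denom_pos:
  assumes x: "x \<in> usphere k" and y: "y \<in> usphere k" and ne: "x 0 > -1 \<or> y 0 > -1"
  shows "sphere_add_denom k x y > 0"
proof -
  have ge: "x 0 \<ge> -1" "y 0 \<ge> -1"
    using usphere_coord_le[OF x, of 0] usphere_coord_le[OF y, of 0] by auto
  consider "x 0 = -1" | "y 0 = -1" | "x 0 > -1" "y 0 > -1" using ge by linarith
  then show ?thesis
  proof cases
    case 1
    then have "(\<Sum>i=1..k. x i * y i) = 0"
      by (intro sum.neutral) (auto simp: usphere_antipode[OF x])
    then show ?thesis using 1 ne by (simp add: sphere_add_denom_def)
  next
    case 2
    then have "(\<Sum>i=1..k. x i * y i) = 0"
      by (intro sum.neutral) (auto simp: usphere_antipode[OF y])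
    then show ?thesis using 2 ne by (simp add: sphere_add_denom_def)
  next
    case 3
    define p where "p = (1 + x 0) * (1 + y 0)"
    have "p > 0" using 3 by (simp add: p_def)
    moreover have "0 \<le> p * (sphere_add_denom k x y - p)"
      unfolding p_def sum_cross_squares[OF x y, symmetric] by (intro sum_nonneg) auto
    ultimately show ?thesis by (simp add: zero_le_mult_iff)
  qed
qed

lemma sphere_add_in_usphere:
  assumes x: "x \<in> usphere k" and y: "y \<in> usphere k" and ne: "x 0 > -1 \<or> y 0 > -1"
  shows "sphere_add k x y \<in> usphere k"
proof -
  define d p where "d = sphere_add_denom k x y" and "p = (1 + x 0) * (1 + y 0)"
  have d: "d > 0" unfolding d_def by (rule sphere_add_denom_pos[OF assms])
  have "(\<Sum>i=1..k. (sphere_add k x y i)\<^sup>2)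
    = (\<Sum>i=1..k. 4 * ((1 + y 0) * x i + (1 + x 0) * y i)\<^sup>2 / d\<^sup>2)"
    by (intro sum.cong) (auto simp: sphere_add_def d_def power_divide power_mult_distrib
        simp del: distrib_left_numeral)
  also have "\<dots> = 4 * (p * (d - p)) / d\<^sup>2"
    unfolding p_def d_def sum_cross_squares[OF x y, symmetric]
    by (simp only: sum_divide_distrib[symmetric] sum_distrib_left[symmetric])
  finally have "(\<Sum>i\<le>k. (sphere_add k x y i)\<^sup>2) = ((2 * p - d)\<^sup>2 + 4 * (p * (d - p))) / d\<^sup>2"
    unfolding sum_atMost_split1
    by (simp add: sphere_add_def d_def p_def power_divide add_divide_distrib)
  also have "(2 * p - d)\<^sup>2 + 4 * (p * (d - p)) = d\<^sup>2"
    by (simp add: power2_eq_square algebra_simps)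
  finally have "(\<Sum>i\<le>k. (sphere_add k x y i)\<^sup>2) = 1" using d by simp
  moreover have "sphere_add k x y i = 0" if "i > k" for i
    using that usphere_zero[OF x that] usphere_zero[OF y that] by (simp add: sphere_add_def)
  ultimately show ?thesis by (simp add: usphere_def)
qed

lemma sphere_add_base_right: "sphere_add k x base_pt = x"
  and sphere_add_base_left: "sphere_add k base_pt x = x"
proof -
  have "(\<Sum>i=1..k. x i * base_pt i) = 0" "(\<Sum>i=1..k. base_pt i * x i) = 0"
    by (intro sum.neutral; simp)+
  then have "sphere_add_denom k x base_pt = 4" "sphere_add_denom k base_pt x = 4"
    by (simp_all add: sphere_add_denom_def)
  then show "sphere_add k x base_pt = x" "sphere_add k base_pt x = x"
    by (auto simp: sphere_add_def)
qed

lemma continuous_on_sphere_add: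
  assumes "continuous_on S f" "continuous_on S g"
    and "\<And>z. z \<in> S \<Longrightarrow> f z \<in> usphere k" "\<And>z. z \<in> S \<Longrightarrow> g z \<in> usphere k"
    and "\<And>z. z \<in> S \<Longrightarrow> f z 0 > -1 \<or> g z 0 > -1"
  shows "continuous_on S (\<lambda>z. sphere_add k (f z) (g z))"
proof -
  note co = continuous_on_coord[OF assms(1)] continuous_on_coord[OF assms(2)]
  have den: "continuous_on S (\<lambda>z. sphere_add_denom k (f z) (g z))"
    unfolding sphere_add_denom_def by (intro continuous_intros co)
  have "continuous_on S (\<lambda>z. sphere_add k (f z) (g z) i)" for i
    unfolding sphere_add_def
    by (cases "i = 0")
      (auto intro!: continuous_intros co den simp: less_imp_neq[OF sphere_add_denom_pos, symmetric] assms)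
  then show ?thesis by (intro continuous_on_coordinatewise_then_product)
qed

lemma pointed_homotopy_sphere_add:
  assumes "continuous_on ({0..1::real} \<times> usphere n) H" "continuous_on ({0..1} \<times> usphere n) K"
    and "\<And>t x. t \<in> {0..1} \<Longrightarrow> x \<in> usphere n \<Longrightarrow> H (t, x) \<in> usphere k"
    and "\<And>t x. t \<in> {0..1} \<Longrightarrow> x \<in> usphere n \<Longrightarrow> K (t, x) \<in> usphere k"
    and "\<And>t x. t \<in> {0..1} \<Longrightarrow> x \<in> usphere n \<Longrightarrow> H (t, x) 0 > -1 \<or> K (t, x) 0 > -1"
    and "\<And>t. t \<in> {0..1} \<Longrightarrow> H (t, base_pt) = base_pt" "\<And>t. t \<in> {0..1} \<Longrightarrow> K (t, base_pt) = base_pt"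
  shows "(\<lambda>x. sphere_add k (H (0, x)) (K (0, x)), \<lambda>x. sphere_add k (H (1, x)) (K (1, x)))
    \<in> pointed_homotopy n k"
proof (rule pointed_homotopyI)
  show "continuous_on ({0..1} \<times> usphere n) (\<lambda>z. sphere_add k (H z) (K z))"
    by (rule continuous_on_sphere_add[OF assms(1,2)]; use assms(3-5) in blast)
  show "sphere_add k (H (t, x)) (K (t, x)) \<in> usphere k" if "t \<in> {0..1}" "x \<in> usphere n" for t x
    by (rule sphere_add_in_usphere) (rule assms(3-5)[OF that])+
qed (simp_all add: assms(6,7) sphere_add_base_left)

section \<open>Rational functions and composition of regular maps\<close>

definition rational_on :: "nat \<Rightarrow> (nat \<Rightarrow> real) set \<Rightarrow> ((nat \<Rightarrow> real) \<Rightarrow> real) \<Rightarrow> bool"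
  where "rational_on m X h \<longleftrightarrow> (\<exists>P Q. poly_fun m P \<and> poly_fun m Q \<and>
    (\<forall>x\<in>X. Q x \<noteq> 0) \<and> (\<forall>x\<in>X. h x = P x / Q x))"

lemma regular_map_iff:
  "regular_map a X b Y f \<longleftrightarrow> f ` X \<subseteq> Y \<and> (\<forall>i<b. rational_on a X (\<lambda>x. f x i))"
  by (simp add: regular_map_def rational_on_def)

lemma rational_onI:
  assumes "poly_fun m P" "poly_fun m Q" "\<And>x. x \<in> X \<Longrightarrow> Q x \<noteq> 0" "\<And>x. x \<in> X \<Longrightarrow> h x = P x / Q x"
  shows "rational_on m X h"
  using assms by (auto simp: rational_on_def)

lemma rational_onE:
  assumes "rational_on m X h"
  obtains P Q where "poly_fun m P" "poly_fun m Q" "\<forall>x\<in>X. Q x \<noteq> 0" "\<forall>x\<in>X. h x = P x / Q x"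
  using assms by (auto simp: rational_on_def)

lemma rational_on_const: "rational_on m X (\<lambda>x. c)"
  by (rule rational_onI[of _ "\<lambda>x. c" "\<lambda>x. 1"]) (auto intro: poly_fun.intros)

lemma rational_on_coord: "i < m \<Longrightarrow> rational_on m X (\<lambda>x. x i)"
  by (rule rational_onI[of _ "\<lambda>x. x i" "\<lambda>x. 1"]) (auto intro: poly_fun.intros)

lemma rational_on_add:
  assumes f: "rational_on m X f" and g: "rational_on m X g"
  shows "rational_on m X (\<lambda>x. f x + g x)"
proof -
  obtain P Q where 1: "poly_fun m P" "poly_fun m Q" "\<forall>x\<in>X. Q x \<noteq> 0" "\<forall>x\<in>X. f x = P x / Q x"
    by (rule rational_onE[OF f])
  obtain P' Q' where 2: "poly_fun m P'" "poly_fun m Q'" "\<forall>x\<in>X. Q' x \<noteq> 0" "\<forall>x\<in>X. g x = P' x / Q' x"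
    by (rule rational_onE[OF g])
  show ?thesis
    by (rule rational_onI[of _ "\<lambda>x. P x * Q' x + P' x * Q x" "\<lambda>x. Q x * Q' x"])
      (use 1 2 in \<open>auto intro!: poly_fun.add poly_fun.mult simp: add_frac_eq\<close>)
qed

lemma rational_on_mult:
  assumes f: "rational_on m X f" and g: "rational_on m X g"
  shows "rational_on m X (\<lambda>x. f x * g x)"
proof -
  obtain P Q where 1: "poly_fun m P" "poly_fun m Q" "\<forall>x\<in>X. Q x \<noteq> 0" "\<forall>x\<in>X. f x = P x / Q x"
    by (rule rational_onE[OF f])
  obtain P' Q' where 2: "poly_fun m P'" "poly_fun m Q'" "\<forall>x\<in>X. Q' x \<noteq> 0" "\<forall>x\<in>X. g x = P' x / Q' x"
    by (rule rational_onE[OF g])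
  show ?thesis
    by (rule rational_onI[of _ "\<lambda>x. P x * P' x" "\<lambda>x. Q x * Q' x"])
      (use 1 2 in \<open>auto intro!: poly_fun.mult\<close>)
qed

lemma rational_on_diff:
  assumes "rational_on m X f" "rational_on m X g"
  shows "rational_on m X (\<lambda>x. f x - g x)"
  using rational_on_add[OF assms(1) rational_on_mult[OF rational_on_const[of m X "-1"] assms(2)]] by simp

lemma rational_on_divide:
  assumes f: "rational_on m X f" and g: "rational_on m X g" and nz: "\<And>x. x \<in> X \<Longrightarrow> g x \<noteq> 0"
  shows "rational_on m X (\<lambda>x. f x / g x)"
proof -
  obtain P Q where 1: "poly_fun m P" "poly_fun m Q" "\<forall>x\<in>X. Q x \<noteq> 0" "\<forall>x\<in>X. f x = P x / Q x"
    by (rule rational_onE[OF f])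
  obtain P' Q' where 2: "poly_fun m P'" "poly_fun m Q'" "\<forall>x\<in>X. Q' x \<noteq> 0" "\<forall>x\<in>X. g x = P' x / Q' x"
    by (rule rational_onE[OF g])
  have "P' x \<noteq> 0" if "x \<in> X" for x using nz[OF that] 2(4) that by auto
  then show ?thesis
    by (intro rational_onI[of _ "\<lambda>x. P x * Q' x" "\<lambda>x. Q x * P' x"])
      (use 1 2 in \<open>auto intro!: poly_fun.mult\<close>)
qed

lemma rational_on_sum:
  assumes "\<And>i. i \<in> I \<Longrightarrow> rational_on m X (\<lambda>x. f x i)"
  shows "rational_on m X (\<lambda>x. \<Sum>i\<in>I. f x i)"
  using assms
  by (induction I rule: infinite_finite_induct) (auto intro: rational_on_const rational_on_add)

lemmas rational_on_intros =
  rational_on_const rational_on_coord rational_on_add rational_on_mult rational_on_diff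
  rational_on_divide rational_on_sum

lemma rational_on_poly_comp:
  assumes "poly_fun b P" "\<And>i. i < b \<Longrightarrow> rational_on a X (\<lambda>x. p x i)"
  shows "rational_on a X (\<lambda>x. P (p x))"
  using assms by induction (auto intro: rational_on_intros)

lemma regular_map_comp:
  assumes f: "regular_map b Y c Z f" and p: "regular_map a X b Y p"
  shows "regular_map a X c Z (f \<circ> p)"
  unfolding regular_map_iff
proof (intro conjI allI impI)
  have p': "p ` X \<subseteq> Y" "\<And>i. i < b \<Longrightarrow> rational_on a X (\<lambda>x. p x i)"
    using p by (auto simp: regular_map_iff)
  show "(f \<circ> p) ` X \<subseteq> Z"
    using f p by (simp add: regular_map_iff image_subset_iff)
  fix i assume "i < c"
  then have "rational_on b Y (\<lambda>x. f x i)" using f by (simp add: regular_map_iff)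
  then obtain P Q where PQ: "poly_fun b P" "poly_fun b Q" "\<forall>x\<in>Y. Q x \<noteq> 0"
    "\<forall>x\<in>Y. f x i = P x / Q x"
    by (rule rational_onE)
  \<comment> \<open>\<open>Q\<close> has no zero on \<open>Y\<close> and \<open>p\<close> maps
    \<open>X\<close> into \<open>Y\<close>, so \<open>Q (p x)\<close> has no zero on
    \<open>X\<close>.\<close>
  have "rational_on a X (\<lambda>x. P (p x) / Q (p x))"
    by (intro rational_on_divide rational_on_poly_comp[OF PQ(1)] rational_on_poly_comp[OF PQ(2)] p')
      (use p' PQ in auto)
  moreover have "f (p x) i = P (p x) / Q (p x)" if "x \<in> X" for x
    using PQ(4) p'(1) that by auto
  ultimately show "rational_on a X (\<lambda>x. (f \<circ> p) x i)"
    unfolding rational_on_def by simp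
qed

abbreviation regular_sphere_map :: "nat \<Rightarrow> nat \<Rightarrow> ((nat \<Rightarrow> real) \<Rightarrow> (nat \<Rightarrow> real)) \<Rightarrow> bool"
  where "regular_sphere_map n k \<equiv> regular_map (Suc n) (usphere n) (Suc k) (usphere k)"

lemma regular_const: "regular_sphere_map n k const_base"
  by (auto simp: regular_map_iff intro: rational_on_const)

lemma regular_reflect1: "regular_sphere_map n n reflect1"
  unfolding regular_map_iff
proof (intro conjI allI impI)
  show "reflect1 ` usphere n \<subseteq> usphere n"
    using reflect1_pointed[of n] by (simp only: pointed_maps_iff)
  show "rational_on (Suc n) (usphere n) (\<lambda>x. reflect1 x i)" if "i < Suc n" for i
    using rational_on_diff[OF rational_on_const[of _ _ 0] rational_on_coord[OF that]]
      rational_on_coord[OF that] by (cases "i = 1") (simp_all add: reflect1_def)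
qed

lemma regular_shift:
  assumes n: "n \<ge> 1" shows "regular_sphere_map n n shift"
  unfolding regular_map_iff
proof (intro conjI allI impI)
  show "shift ` usphere n \<subseteq> usphere n"
    using shift_in_usphere n by auto
  have nz: "3 - x 0 - 2 * x 1 \<noteq> 0" if "x \<in> usphere n" for x
    using shift_denom_pos[OF that n] by simp
  show "rational_on (Suc n) (usphere n) (\<lambda>x. shift x i)" if "i < Suc n" for i
    unfolding shift_def using n that nz
    by (cases "i = 0"; cases "i = 1") (auto intro!: rational_on_intros)
qed

lemma regular_sphere_add:
  assumes f: "regular_sphere_map n k f" and g: "regular_sphere_map n k g"
    and ne: "\<And>x. x \<in> usphere n \<Longrightarrow> f x 0 > -1 \<or> g x 0 > -1"
  shows "regular_sphere_map n k (\<lambda>x. sphere_add k (f x) (g x))"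
  unfolding regular_map_iff
proof (intro conjI allI impI)
  have im: "f x \<in> usphere k" "g x \<in> usphere k" if "x \<in> usphere n" for x
    using f g that by (auto simp: regular_map_iff)
  have rat: "rational_on (Suc n) (usphere n) (\<lambda>x. f x i)" "rational_on (Suc n) (usphere n) (\<lambda>x. g x i)"
    if "i \<le> k" for i
    using f g that by (auto simp: regular_map_iff)
  have den: "rational_on (Suc n) (usphere n) (\<lambda>x. sphere_add_denom k (f x) (g x))"
    unfolding sphere_add_denom_def by (intro rational_on_intros rat) auto
  have nz: "sphere_add_denom k (f x) (g x) \<noteq> 0" if "x \<in> usphere n" for x
    using sphere_add_denom_pos[OF im[OF that] ne[OF that]] by simp
  show "(\<lambda>x. sphere_add k (f x) (g x)) ` usphere n \<subseteq> usphere k"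
    using sphere_add_in_usphere im ne by auto
  show "rational_on (Suc n) (usphere n) (\<lambda>x. sphere_add k (f x) (g x) i)" if "i < Suc k" for i
    unfolding sphere_add_def using that
    by (cases "i = 0") (auto intro!: rational_on_intros rat den nz)
qed

section \<open>Dilation of the source\<close>

text \<open>Multiplication by \<open>r\<close> in \<open>\<real>\<^sup>n \<union> {\<infinity>}\<close>, with \<open>\<infinity>\<close> the base point.\<close>

definition dilate :: "real \<Rightarrow> (nat \<Rightarrow> real) \<Rightarrow> nat \<Rightarrow> real"
  where "dilate r x = (\<lambda>i. (if i = 0 then r\<^sup>2 * (1 + x 0) - (1 - x 0) else 2 * r * x i)
     / (r\<^sup>2 * (1 + x 0) + (1 - x 0)))"

text \<open>As \<open>1 + x 0 \<ge> 0\<close>, the denominator is smallest at \<open>r = 1\<close>,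
  where it equals 2.\<close>

lemma dilate_denom_pos:
  assumes x: "x \<in> usphere n" and r: "r \<ge> 1"
  shows "0 < r\<^sup>2 * (1 + x 0) + (1 - x 0)"
proof -
  have "1 * (1 + x 0) \<le> r\<^sup>2 * (1 + x 0)"
    using r usphere_coord_le[OF x, of 0] by (intro mult_right_mono) (auto simp: one_le_power)
  then show ?thesis by simp
qed

lemma dilate_in_usphere:
  assumes x: "x \<in> usphere n" and r: "r \<ge> 1"
  shows "dilate r x \<in> usphere n"
proof -
  define d where "d = r\<^sup>2 * (1 + x 0) + (1 - x 0)"
  have d: "d > 0" unfolding d_def by (rule dilate_denom_pos[OF assms])
  have "(\<Sum>i=1..n. (dilate r x i)\<^sup>2) = (\<Sum>i=1..n. 4 * r\<^sup>2 * (x i)\<^sup>2 / d\<^sup>2)"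
    by (intro sum.cong) (auto simp: dilate_def d_def power_divide power_mult_distrib)
  also have "\<dots> = 4 * r\<^sup>2 * (1 - (x 0)\<^sup>2) / d\<^sup>2"
    unfolding usphere_sum1[OF x, symmetric]
    by (simp only: sum_divide_distrib[symmetric] sum_distrib_left[symmetric])
  finally have "(\<Sum>i\<le>n. (dilate r x i)\<^sup>2)
    = ((r\<^sup>2 * (1 + x 0) - (1 - x 0))\<^sup>2 + 4 * r\<^sup>2 * (1 - (x 0)\<^sup>2)) / d\<^sup>2"
    unfolding sum_atMost_split1 by (simp add: dilate_def d_def power_divide add_divide_distrib)
  also have "(r\<^sup>2 * (1 + x 0) - (1 - x 0))\<^sup>2 + 4 * r\<^sup>2 * (1 - (x 0)\<^sup>2) = d\<^sup>2"
    by (simp add: d_def power2_eq_square algebra_simps)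
  finally have "(\<Sum>i\<le>n. (dilate r x i)\<^sup>2) = 1" using d by simp
  then show ?thesis using x by (simp add: usphere_def dilate_def)
qed

lemma dilate_base_pt: "r \<ge> 1 \<Longrightarrow> dilate r base_pt = base_pt"
  by (rule ext) (auto simp: dilate_def)

lemma dilate_homotopic_id:
  assumes r: "r \<ge> 1"
  shows "(id, dilate r) \<in> pointed_homotopy n n"
proof (rule pointed_homotopyI)
  let ?r = "\<lambda>t. 1 + t * (r - 1)"
  have r1: "?r t \<ge> 1" if "t \<in> {0..1}" for t using that r by simp
  have nz: "(?r (fst z))\<^sup>2 * (1 + snd z 0) + (1 - snd z 0) \<noteq> 0" if "z \<in> {0..1} \<times> usphere n" for z
  proof -
    have "snd z \<in> usphere n" "fst z \<in> {0..1}" using that by auto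
    from dilate_denom_pos[OF this(1) r1[OF this(2)]] show ?thesis by simp
  qed
  have "continuous_on ({0..1} \<times> usphere n) (\<lambda>z. dilate (?r (fst z)) (snd z) i)" for i
    unfolding dilate_def using nz
    by (cases "i = 0") (auto intro!: continuous_intros continuous_on_coord_snd)
  then show "continuous_on ({0..1} \<times> usphere n) (\<lambda>z. dilate (?r (fst z)) (snd z))"
    by (intro continuous_on_coordinatewise_then_product)
  show "dilate (?r (fst (t, x))) (snd (t, x)) \<in> usphere n" if "t \<in> {0..1}" "x \<in> usphere n" for t x
    using dilate_in_usphere[OF that(2) r1[OF that(1)]] by simp
  show "dilate (?r (fst (t, base_pt))) (snd (t, base_pt)) = base_pt" if "t \<in> {0..1}" for t
    using dilate_base_pt[OF r1[OF that]] by simp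
qed (auto simp: dilate_def)

lemma regular_dilate:
  assumes r: "r \<ge> 1" shows "regular_sphere_map n n (dilate r)"
  unfolding regular_map_iff
proof (intro conjI allI impI)
  show "dilate r ` usphere n \<subseteq> usphere n"
    using dilate_in_usphere r by auto
  have nz: "r\<^sup>2 * (1 + x 0) + (1 - x 0) \<noteq> 0" if "x \<in> usphere n" for x
    using dilate_denom_pos[OF that r] by simp
  show "rational_on (Suc n) (usphere n) (\<lambda>x. dilate r x i)" if "i < Suc n" for i
    unfolding dilate_def using that nz
    by (cases "i = 0") (auto intro!: rational_on_intros)
qed

text \<open>The preimage of the antipode of the base point is bounded in \<open>\<real>\<^sup>n\<close>, so a dilation shrinks it
  into the unit ball \<open>x 0 < 0\<close>.\<close>

lemma ex_dilate_avoiding_antipode: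
  assumes f: "f \<in> pointed_maps n k"
  obtains r where "r \<ge> 1" "\<And>x. x \<in> usphere n \<Longrightarrow> x 0 \<ge> 0 \<Longrightarrow> f (dilate r x) 0 > -1"
proof -
  \<comment> \<open>Coordinates are at least -1 on the sphere, so \<open>K\<close> is the set of
    poles of \<open>f\<close>; the inequality exhibits it as a closed preimage.\<close>
  define K where "K = {x \<in> usphere n. f x 0 \<le> -1}"
  have cf: "continuous_on (usphere n) (\<lambda>x. f x 0)"
    by (rule continuous_on_coord) (use f in \<open>simp add: pointed_maps_iff\<close>)
  have "K = usphere n \<inter> (\<lambda>x. f x 0) -` {..-1}" by (auto simp: K_def)
  moreover have "closedin (top_of_set (usphere n)) (usphere n \<inter> (\<lambda>x. f x 0) -` {..-1})"
    by (rule continuous_closedin_preimage[OF cf]) simp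
  ultimately have "compact K"
    using closedin_compact[OF compact_usphere] by simp
  \<comment> \<open>The maximum of \<open>x 0\<close> over the poles is below 1 because
    \<open>base_pt\<close> is not a pole.\<close>
  have "\<exists>m<1. m \<ge> -1 \<and> (\<forall>x\<in>K. x 0 \<le> m)"
  proof (cases "K = {}")
    case True
    then show ?thesis by (intro exI[of _ 0]) auto
  next
    case False
    obtain y where y: "y \<in> K" "\<forall>x\<in>K. x 0 \<le> y 0"
      using continuous_attains_sup[OF \<open>compact K\<close> False continuous_on_coord_id] by blast
    then have yu: "y \<in> usphere n" by (simp add: K_def)
    have "y 0 \<noteq> 1"
    proof
      assume "y 0 = 1"
      then have "y = base_pt" by (rule usphere_coord0_eq_1[OF yu])
      then show False using y(1) pointed_maps_base[OF f] by (simp add: K_def)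
    qed
    then show ?thesis
      using y(2) usphere_coord_le[OF yu, of 0] by (intro exI[of _ "y 0"]) auto
  qed
  then obtain m where m: "m < 1" "m \<ge> -1" "\<And>x. x \<in> K \<Longrightarrow> x 0 \<le> m" by blast
  \<comment> \<open>A pole of the dilated map with \<open>x 0 \<ge> 0\<close> would give
    \<open>r\<^sup>2 * (1 - m) \<le> 1 + m < 2\<close>. This choice makes
    \<open>r * (1 - m) = 2\<close> and \<open>r \<ge> 1\<close>, hence
    \<open>r\<^sup>2 * (1 - m) \<ge> 2\<close>.\<close>
  define r where "r = 2 / (1 - m)"
  have r: "r \<ge> 1" using m by (simp add: r_def)
  show ?thesis
  proof (rule that[OF r], rule ccontr)
    fix x assume x: "x \<in> usphere n" "x 0 \<ge> 0" and "\<not> f (dilate r x) 0 > -1"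
    then have "dilate r x \<in> K" using dilate_in_usphere[OF x(1) r] by (simp add: K_def)
    then have "dilate r x 0 \<le> m" by (rule m(3))
    then have "r\<^sup>2 * (1 + x 0) - (1 - x 0) \<le> m * (r\<^sup>2 * (1 + x 0) + (1 - x 0))"
      using dilate_denom_pos[OF x(1) r] by (simp add: dilate_def pos_divide_le_eq)
    then have "r\<^sup>2 * (1 - m) * (1 + x 0) \<le> (1 + m) * (1 - x 0)"
      by (simp add: algebra_simps)
    moreover have "(1 + m) * (1 - x 0) \<le> (1 + m) * 1"
      using m x by (intro mult_left_mono) auto
    moreover have "2 * 1 \<le> (r\<^sup>2 * (1 - m)) * (1 + x 0)"
    proof (rule mult_mono)
      have "r * 1 \<le> r * r" using r by (intro mult_left_mono) auto
      then have "r * (1 - m) \<le> r\<^sup>2 * (1 - m)"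
        using m by (intro mult_right_mono) (auto simp: power2_eq_square)
      moreover have "r * (1 - m) = 2" using m by (simp add: r_def field_simps)
      ultimately show "2 \<le> r\<^sup>2 * (1 - m)" by simp
    qed (use m x in auto)
    ultimately have "2 * 1 \<le> (1 + m) * 1" by (blast intro: order_trans)
    then show False using m(1) by simp
  qed
qed

section \<open>Regular representatives of products\<close>

text \<open>Conjugation by \<open>reflect1\<close> turns translation by -p into translation by p, so
  the second summand mirrors the first. At the end of the homotopy at least one argument of
  \<open>sphere_add\<close> is its neutral element \<open>base_pt\<close>, which leaves
  \<open>f\<close> on one hemisphere and \<open>g\<close> on the other.\<close>

lemma sphere_mult_homotopic_sphere_add:
  assumes n: "n \<ge> 1" and f: "f \<in> pointed_maps n k" and g: "g \<in> pointed_maps n k"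
    and f_ne: "\<And>x. x \<in> usphere n \<Longrightarrow> x 0 \<ge> 0 \<Longrightarrow> f x 0 > -1"
    and g_ne: "\<And>x. x \<in> usphere n \<Longrightarrow> x 0 \<ge> 0 \<Longrightarrow> g x 0 > -1"
  shows "(\<lambda>x. sphere_add k (f (shift x)) (g (reflect1 (shift (reflect1 x)))), sphere_mult f g)
    \<in> pointed_homotopy n k"
proof -
  let ?psi = "sphere_mult id const_base"
  define A where "A = (\<lambda>(t, x). great_arc n t (shift x) (?psi x))"
  have psi: "?psi \<in> pointed_maps n n"
    by (intro sphere_mult_pointed n id_pointed const_pointed)
  note sh = shift_pointed[OF n]
  have A: "continuous_on ({0..1} \<times> usphere n) A"
    unfolding A_def by (rule continuous_on_great_arc[OF sh psi shift_sphere_mult_not_antipodal[OF _ n]])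
  have A_in: "A (t, x) \<in> usphere n" if "t \<in> {0..1}" "x \<in> usphere n" for t x
    using that unfolding A_def prod.case
    by (intro great_arc_in_usphere shift_sphere_mult_not_antipodal n pointed_maps_in[OF sh] pointed_maps_in[OF psi])
  have A_base: "A (t, base_pt) = base_pt" for t
    by (simp add: A_def pointed_maps_base[OF sh] great_arc_same[of _ n])
  \<comment> \<open>Pinching sends this hemisphere to \<open>base_pt\<close> and
    \<open>shift\<close> sends it into \<open>x 0 \<ge> 0\<close>, so the arcs stay in that half,
    away from the poles of \<open>f\<close>.\<close>
  have A_nonneg: "A (t, x) 0 \<ge> 0" if "t \<in> {0..1}" "x \<in> usphere n" "x 1 \<le> 0" for t x
  proof -
    have "?psi x = base_pt" using that(3) pinch_equator[of x] by (auto simp: sphere_mult_def)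
    then show ?thesis
      using great_arc_coord0_nonneg[of "shift x" base_pt t n] shift_coord0_nonneg[OF that(2) n that(3)] that(1)
      by (simp add: A_def)
  qed
  have rf: "reflect1 x \<in> usphere n" if "x \<in> usphere n" for x
    using pointed_maps_in[OF reflect1_pointed that] .
  have gr: "g \<circ> reflect1 \<in> pointed_maps n k"
    by (rule pointed_maps_comp[OF g reflect1_pointed])
  let ?H = "\<lambda>z. f (A z)" and ?K = "\<lambda>z. (g \<circ> reflect1) (A (fst z, reflect1 (snd z)))"
  have h: "(\<lambda>x. sphere_add k (?H (0, x)) (?K (0, x)), \<lambda>x. sphere_add k (?H (1, x)) (?K (1, x)))
    \<in> pointed_homotopy n k"
  proof (rule pointed_homotopy_sphere_add)
    show "continuous_on ({0..1} \<times> usphere n) ?H"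
      by (rule continuous_on_compose2[OF _ A, of "usphere n"])
        (use f A_in in \<open>auto simp: pointed_maps_iff\<close>)
    have "continuous_on ({0..1} \<times> usphere n) (\<lambda>z. A (fst z, reflect1 (snd z)))"
      by (rule continuous_on_compose2[OF A])
        (auto intro!: continuous_intros continuous_on_pointed_snd[OF reflect1_pointed] rf)
    then show "continuous_on ({0..1} \<times> usphere n) ?K"
    proof (rule continuous_on_compose2[rotated])
      show "continuous_on (usphere n) (g \<circ> reflect1)"
        using gr unfolding pointed_maps_iff by blast
    qed (use A_in rf in auto)
    fix t :: real assume t: "t \<in> {0..1}"
    show "?H (t, base_pt) = base_pt" "?K (t, base_pt) = base_pt"
      by (simp_all add: A_base pointed_maps_base[OF f] pointed_maps_base[OF g])
    fix x assume x: "x \<in> usphere n"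
    show "?H (t, x) \<in> usphere k"
      by (rule pointed_maps_in[OF f A_in[OF t x]])
    show "?K (t, x) \<in> usphere k"
      using pointed_maps_in[OF gr A_in[OF t rf[OF x]]] by simp
    \<comment> \<open>One of \<open>x\<close> and \<open>reflect1 x\<close> has nonpositive
      coordinate 1, so one of the two summands is evaluated in the half free of poles.\<close>
    show "?H (t, x) 0 > -1 \<or> ?K (t, x) 0 > -1"
    proof (cases "x 1 \<le> 0")
      case True
      then show ?thesis using f_ne[OF A_in[OF t x] A_nonneg[OF t x]] by simp
    next
      case False
      then have "reflect1 x 1 \<le> 0" by (simp add: reflect1_def)
      then have "reflect1 (A (t, reflect1 x)) 0 \<ge> 0"
        using A_nonneg[OF t rf[OF x]] by (simp add: reflect1_def)
      then show ?thesis using g_ne[OF rf[OF A_in[OF t rf[OF x]]]] by simp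
    qed
  qed
  have e0: "sphere_add k (?H (0, x)) (?K (0, x))
      = sphere_add k (f (shift x)) (g (reflect1 (shift (reflect1 x))))" if "x \<in> usphere n" for x
    by (simp add: A_def great_arc_0 pointed_maps_in[OF sh] rf that)
  have e1: "sphere_add k (?H (1, x)) (?K (1, x)) = sphere_mult f g x" if "x \<in> usphere n" for x
  proof -
    have "sphere_add k (?H (1, x)) (?K (1, x))
        = sphere_add k (f (?psi x)) (g (reflect1 (?psi (reflect1 x))))"
      by (simp add: A_def great_arc_1 pointed_maps_in[OF psi] rf that)
    also have "\<dots> = sphere_mult f g x"
    proof (cases "x 1 \<ge> 0")
      case True
      then have "?psi x = pinch x" "?psi (reflect1 x) = base_pt"
        using pinch_equator[of "reflect1 x"] by (auto simp: sphere_mult_def reflect1_def)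
      then show ?thesis
        using True by (simp add: sphere_mult_def pointed_maps_base[OF g] sphere_add_base_right)
    next
      case False
      then have "?psi x = base_pt" "?psi (reflect1 x) = reflect1 (pinch x)"
        by (auto simp: sphere_mult_def pinch_reflect1[symmetric]) (auto simp: reflect1_def)
      then show ?thesis
        using False by (simp add: sphere_mult_def pointed_maps_base[OF f] sphere_add_base_left)
    qed
    finally show ?thesis .
  qed
  \<comment> \<open>The ends of the homotopy are compared with the claimed maps on the sphere alone,
    hence the two extra links in the chain.\<close>
  note pointed_homotopy_sym[OF pointed_homotopy_eq[OF pointed_homotopy_maps(1)[OF h] e0]]
  also note h
  also note pointed_homotopy_eq[OF pointed_homotopy_maps(2)[OF h] e1]
  finally show ?thesis .
qed

theorem theorem1p1:
  fixes n k :: nat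
  assumes "n \<ge> 1" and "k \<ge> 1"
  shows "subgroup (alg_homotopy_classes n k) (homotopy_group n k)"
proof
  let ?G = "homotopy_group n k" and ?c = "\<lambda>f. pointed_homotopy n k `` {f}"
  note n = assms(1)
  have algI: "?c f \<in> alg_homotopy_classes n k" if "f \<in> pointed_maps n k" "regular_sphere_map n k f" for f
    using that pointed_homotopy_refl[OF that(1)] homotopy_class_in_carrier[OF that(1)]
    by (auto simp: alg_homotopy_classes_def topspace_nsphere)
  \<comment> \<open>\<open>alg_homotopy_classes\<close> asks for a regular member without mentioning
    the base point; membership in the class already makes it pointed.\<close>
  have algE: "\<exists>f. f \<in> pointed_maps n k \<and> regular_sphere_map n k f \<and> A = ?c f"
    if A: "A \<in> alg_homotopy_classes n k" for A
  proof -
    obtain f where f: "f \<in> A" "regular_sphere_map n k f" and Ac: "A \<in> carrier ?G"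
      using A unfolding alg_homotopy_classes_def topspace_nsphere by blast
    obtain f0 where f0: "f0 \<in> pointed_maps n k" "A = ?c f0"
      by (rule homotopy_group_carrierE[OF Ac])
    have "(f0, f) \<in> pointed_homotopy n k" using f f0 by simp
    then have "f \<in> pointed_maps n k" "?c f0 = ?c f"
      using pointed_homotopy_maps homotopy_class_eq_iff[of f0 n k f] by blast+
    then show ?thesis using f(2) f0(2) by blast
  qed
  show "alg_homotopy_classes n k \<subseteq> carrier ?G"
    by (auto simp: alg_homotopy_classes_def)
  show "\<one>\<^bsub>?G\<^esub> \<in> alg_homotopy_classes n k"
    unfolding one_homotopy_group by (intro algI const_pointed regular_const)
  show "inv\<^bsub>?G\<^esub> A \<in> alg_homotopy_classes n k" if A: "A \<in> alg_homotopy_classes n k" for A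
  proof -
    obtain f where f: "f \<in> pointed_maps n k" "regular_sphere_map n k f" "A = ?c f"
      using algE[OF A] by blast
    show ?thesis
      unfolding f(3) inv_homotopy_group[OF n f(1)]
      by (intro algI pointed_maps_comp[OF f(1)] regular_map_comp[OF f(2)] reflect1_pointed regular_reflect1)
  qed
  show "A \<otimes>\<^bsub>?G\<^esub> B \<in> alg_homotopy_classes n k"
    if AB: "A \<in> alg_homotopy_classes n k" "B \<in> alg_homotopy_classes n k" for A B
  proof -
    \<comment> \<open>Precomposing with a dilation keeps the class and regularity, and moves all
      poles into \<open>x 0 < 0\<close>.\<close>
    have ex: "\<exists>f. f \<in> pointed_maps n k \<and> regular_sphere_map n k f \<and> A = ?c f \<and>
        (\<forall>x\<in>usphere n. x 0 \<ge> 0 \<longrightarrow> f x 0 > -1)" if A: "A \<in> alg_homotopy_classes n k" for A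
    proof -
      obtain f where f: "f \<in> pointed_maps n k" "regular_sphere_map n k f" "A = ?c f"
        using algE[OF A] by blast
      obtain r where r: "r \<ge> 1" "\<And>x. x \<in> usphere n \<Longrightarrow> x 0 \<ge> 0 \<Longrightarrow> f (dilate r x) 0 > -1"
        by (rule ex_dilate_avoiding_antipode[OF f(1)]) blast
      have h: "(f, f \<circ> dilate r) \<in> pointed_homotopy n k"
        using pointed_homotopy_comp_left[OF dilate_homotopic_id[OF r(1)] f(1)] by simp
      have "f \<circ> dilate r \<in> pointed_maps n k" by (rule pointed_homotopy_maps(2)[OF h])
      moreover have "A = ?c (f \<circ> dilate r)"
        unfolding f(3) using homotopy_class_eq_iff[OF pointed_homotopy_maps[OF h]] h by blast
      moreover have "regular_sphere_map n k (f \<circ> dilate r)"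
        by (rule regular_map_comp[OF f(2) regular_dilate[OF r(1)]])
      ultimately show ?thesis using r(2) by (intro exI[of _ "f \<circ> dilate r"]) simp
    qed
    obtain f where f: "f \<in> pointed_maps n k" "regular_sphere_map n k f" "A = ?c f"
      "\<And>x. x \<in> usphere n \<Longrightarrow> x 0 \<ge> 0 \<Longrightarrow> f x 0 > -1"
      using ex[OF AB(1)] by blast
    obtain g where g: "g \<in> pointed_maps n k" "regular_sphere_map n k g" "B = ?c g"
      "\<And>x. x \<in> usphere n \<Longrightarrow> x 0 \<ge> 0 \<Longrightarrow> g x 0 > -1"
      using ex[OF AB(2)] by blast
    let ?F = "\<lambda>x. sphere_add k (f (shift x)) (g (reflect1 (shift (reflect1 x))))"
    have h: "(?F, sphere_mult f g) \<in> pointed_homotopy n k"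
      by (rule sphere_mult_homotopic_sphere_add[OF n f(1) g(1) f(4) g(4)])
    have rf: "reflect1 x \<in> usphere n" if "x \<in> usphere n" for x
      using pointed_maps_in[OF reflect1_pointed that] .
    \<comment> \<open>Written with compositions so that \<open>regular_map_comp\<close> applies to
      each summand.\<close>
    have "regular_sphere_map n k (\<lambda>x. sphere_add k ((f \<circ> shift) x) ((g \<circ> (reflect1 \<circ> (shift \<circ> reflect1))) x))"
    proof (rule regular_sphere_add)
      show "regular_sphere_map n k (f \<circ> shift)"
        by (intro regular_map_comp[OF f(2)] regular_shift n)
      show "regular_sphere_map n k (g \<circ> (reflect1 \<circ> (shift \<circ> reflect1)))"
        by (rule regular_map_comp[OF g(2) regular_map_comp[OF regular_reflect1
              regular_map_comp[OF regular_shift[OF n] regular_reflect1]]])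
      \<comment> \<open>If a_1 <= 0, then |a - p| >= 1 and \<open>f\<close> has no pole there;
        otherwise |a + p| >= 1 and \<open>g\<close> has none.\<close>
      show "(f \<circ> shift) x 0 > -1 \<or> (g \<circ> (reflect1 \<circ> (shift \<circ> reflect1))) x 0 > -1"
        if x: "x \<in> usphere n" for x
      proof (cases "x 1 \<le> 0")
        case True
        then show ?thesis
          using f(4)[OF shift_in_usphere[OF x n] shift_coord0_nonneg[OF x n]] by simp
      next
        case False
        then have "shift (reflect1 x) 0 \<ge> 0"
          by (intro shift_coord0_nonneg[OF rf[OF x] n]) (simp add: reflect1_def)
        then have "reflect1 (shift (reflect1 x)) 0 \<ge> 0" by (simp add: reflect1_def)
        then show ?thesis using g(4)[OF rf[OF shift_in_usphere[OF rf[OF x] n]]] by simp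
      qed
    qed
    then have "?c ?F \<in> alg_homotopy_classes n k"
      using algI[OF pointed_homotopy_maps(1)[OF h]] by simp
    moreover have "?c ?F = A \<otimes>\<^bsub>?G\<^esub> B"
      using homotopy_class_eq_iff[OF pointed_homotopy_maps[OF h]] h
      unfolding f(3) g(3) homotopy_group_mult[OF n f(1) g(1)] by simp
    ultimately show ?thesis by simp
  qed
qed

end
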